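(* Let $r\neq s$ be positive integers, $n=2r+2s$, and let $T_{2,1},T_{2,2}$ be the two trees with passport $[r^2,s^2;4,1^{n-4};n]$, where the degrees of the black vertices in cyclic order around the degree-$4$ white vertex are $(r,s,r,s)$ for $T_{2,1}$ and $(r,r,s,s)$ for $T_{2,2}$. The Shabat polynomials of these two trees can be obtained by substituting appropriate values for $a,b,c$ in $$P(x)=(x^2+cx+a)^r(x^2-cx+b)^s .$$ (i) For $T_{2,1}$ one sets $a=-\frac{br}{s}$ and $c=0$, where $b\in\mathbb{Q}$ can be chosen arbitrarily. (ii) For $T_{2,2}$ one sets $$a=\frac{1}{108}\,\frac{c^2(32r^3+75r^2s+78rs^2+31s^3)}{(r+s)^2s},\qquad b=\frac{1}{108}\,\frac{c^2(31r^3+75rs^2+78r^2s+32s^3)}{(r+s)^2r},$$ where $c\in\mathbb{Q}$ can be chosen arbitrarily.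
   Context: A Shabat polynomial is a complex polynomial with at most two finite critical values $c_1,c_2$. Its tree is the bicolored plane tree $P^{-1}([c_1,c_2])$, with black vertices the points of $P^{-1}(c_1)$, white vertices the points of $P^{-1}(c_2)$, edges the connected components of the preimage of the open segment $(c_1,c_2)$, and vertex degree equal to the multiplicity of the corresponding root of $P-c_1$ or $P-c_2$. The passport $[\alpha;\beta;n]$ of a tree with $n$ edges records the partition $\alpha\vdash n$ of black vertex degrees and the partition $\beta\vdash n$ of white vertex degrees ($k^m$ means $k$ repeated $m$ times). In the claim, $c_1=0$ (black vertices are the roots of $P$).
   Formalization: The parameters b in (i) and c in (ii) are taken to be nonzero rationals: for the value 0 the polynomial becomes x^(2r+2s), whose tree is a star and not T_{2,1} or T_{2,2}. *)

theory Defs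
  imports "HOL-Analysis.Analysis" "HOL-Computational_Algebra.Polynomial"
begin

definition critical_values :: "complex poly \<Rightarrow> complex set" where
  "critical_values P = poly P ` {z. poly (pderiv P) z = 0}"

definition shabat :: "complex poly \<Rightarrow> complex \<Rightarrow> complex \<Rightarrow> bool" where
  "shabat P c1 c2 \<longleftrightarrow> 0 < degree P \<and> c1 \<noteq> c2 \<and> critical_values P \<subseteq> {c1, c2}"

text \<open>
  The bicolored plane tree of \<open>P\<close> is the preimage of the segment from \<open>c1\<close> to \<open>c2\<close>.
  Black vertices are \<open>vertices P c1\<close>, white vertices are \<open>vertices P c2\<close>.
\<close>

definition vertices :: "complex poly \<Rightarrow> complex \<Rightarrow> complex set" where
  "vertices P c = {z. poly P z = c}"

definition vertex_degree :: "complex poly \<Rightarrow> complex \<Rightarrow> nat" where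
  "vertex_degree P v = order v (P - [:poly P v:])"

definition edges :: "complex poly \<Rightarrow> complex \<Rightarrow> complex \<Rightarrow> complex set set" where
  "edges P c1 c2 = components {z. poly P z \<in> open_segment c1 c2}"

definition degree_partition :: "complex poly \<Rightarrow> complex \<Rightarrow> nat multiset" where
  "degree_partition P c = image_mset (vertex_degree P) (mset_set (vertices P c))"

definition passport :: "complex poly \<Rightarrow> complex \<Rightarrow> complex \<Rightarrow> nat multiset \<times> nat multiset \<times> nat" where
  "passport P c1 c2 = (degree_partition P c1, degree_partition P c2, card (edges P c1 c2))"

text \<open>
  Edges are open arcs, so an edge is incident to the vertices in its closure.
\<close>

definition edges_at :: "complex poly \<Rightarrow> complex \<Rightarrow> complex \<Rightarrow> complex \<Rightarrow> complex set set" where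
  "edges_at P c1 c2 v = {e \<in> edges P c1 c2. v \<in> closure e}"

text \<open>
  The list \<open>es\<close> runs once counterclockwise through the edges at \<open>v\<close>, starting at any one of them:
  \<open>\<theta> i\<close> is an argument of the unit tangent vector of the edge \<open>es ! i\<close> as it leaves \<open>v\<close>. The
  tangents at a vertex are pairwise distinct, as \<open>P\<close> is locally a power map there.
\<close>

definition ccw_edges_at ::
  "complex poly \<Rightarrow> complex \<Rightarrow> complex \<Rightarrow> complex \<Rightarrow> complex set list \<Rightarrow> bool" where
  "ccw_edges_at P c1 c2 v es \<longleftrightarrow>
     distinct es \<and> set es = edges_at P c1 c2 v \<and>
     (\<exists>\<theta> :: nat \<Rightarrow> real.
        strict_mono_on {..<length es} \<theta> \<and>
        (\<forall>i < length es. \<theta> i < \<theta> 0 + 2 * pi \<and>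
           ((\<lambda>z. sgn (z - v)) \<longlongrightarrow> cis (\<theta> i)) (at v within es ! i)))"

text \<open>
  The degrees of the black vertices adjacent to the white vertex \<open>w\<close>, in cyclic order around \<open>w\<close>,
  are \<open>ds\<close>. This is invariant under rotation of \<open>ds\<close>, since the first edge is arbitrary.
\<close>

definition black_degrees_around ::
  "complex poly \<Rightarrow> complex \<Rightarrow> complex \<Rightarrow> complex \<Rightarrow> nat list \<Rightarrow> bool" where
  "black_degrees_around P c1 c2 w ds \<longleftrightarrow>
     (\<exists>es bs. ccw_edges_at P c1 c2 w es \<and>
        list_all2 (\<lambda>e v. v \<in> vertices P c1 \<and> v \<in> closure e) es bs \<and>
        ds = map (vertex_degree P) bs)"

text \<open>
  \<open>P\<close> is a Shabat polynomial, with the black vertices at its roots, whose tree has passport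
  \<open>[r^2,s^2; 4,1^(n-4); n]\<close> with \<open>n = 2r + 2s\<close>, and the black vertices around the white vertex
  of degree 4 have degrees \<open>ds\<close>.
\<close>

definition shabat_tree_with_order :: "nat \<Rightarrow> nat \<Rightarrow> nat list \<Rightarrow> complex poly \<Rightarrow> bool" where
  "shabat_tree_with_order r s ds P \<longleftrightarrow>
     (let n = 2 * r + 2 * s in
      \<exists>c2. shabat P 0 c2 \<and>
        passport P 0 c2 =
          (replicate_mset 2 r + replicate_mset 2 s, {#4#} + replicate_mset (n - 4) 1, n) \<and>
        (\<exists>w \<in> vertices P c2. vertex_degree P w = 4 \<and> black_degrees_around P 0 c2 w ds))"

definition shabat_of_T21 :: "nat \<Rightarrow> nat \<Rightarrow> complex poly \<Rightarrow> bool" where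
  "shabat_of_T21 r s P \<longleftrightarrow> shabat_tree_with_order r s [r, s, r, s] P"

definition shabat_of_T22 :: "nat \<Rightarrow> nat \<Rightarrow> complex poly \<Rightarrow> bool" where
  "shabat_of_T22 r s P \<longleftrightarrow> shabat_tree_with_order r s [r, r, s, s] P"

definition P_family :: "nat \<Rightarrow> nat \<Rightarrow> complex \<Rightarrow> complex \<Rightarrow> complex \<Rightarrow> complex poly" where
  "P_family r s a b c = [:a, c, 1:] ^ r * [:b, - c, 1:] ^ s"

end

theory Submission
  imports Defs "HOL-Complex_Analysis.Complex_Analysis" "HOL-Computational_Algebra.Fundamental_Theorem_Algebra"
begin

text \<open>
  The parameters make the numerator of \<open>P'/P\<close> a constant times \<open>(x - w)\<^sup>3\<close>, so \<open>w\<close> is the only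
  critical point outside the roots; this gives the Shabat property and, by counting
  multiplicities, the vertex degrees. Over the open segment \<open>P\<close> is a trivial covering, hence every
  edge is an open arc on which \<open>P\<close> is injective, and there are \<open>degree P\<close> of them. In a local
  coordinate at \<open>w\<close> with \<open>P - P w = \<phi>\<^sup>4\<close> the edges at \<open>w\<close> are four rays, so their directions are the
  fourth roots of some \<open>\<zeta>\<close>.

  For \<open>T\<^sub>2\<^sub>,\<^sub>1\<close> the segments from \<open>0\<close> to the four roots are mapped into the open segment from \<open>0\<close> to
  \<open>P 0\<close>, because \<open>(1 - y)\<^sup>r (1 + y r/s)\<^sup>s < 1\<close> for \<open>0 < y < 1\<close>; so they are the edges at \<open>0\<close>.

  For \<open>T\<^sub>2\<^sub>,\<^sub>2\<close> both quadratic factors have a pair of nonreal conjugate roots, and conjugation acts on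
  the tree. No edge meets the real axis, so two of the four edges at \<open>w\<close> lie in each half plane. The
  two upper ones cannot end in the same root, as they would bound a region in which \<open>P\<close> is real.
  Hence one ends in the upper root of degree \<open>r\<close>, the other in that of degree \<open>s\<close>, and the lower
  ones are their mirror images.
\<close>

subsection \<open>Fibres and lifting over noncritical values\<close>

lemma order_noncritical:
  fixes P :: "complex poly"
  assumes "0 < degree P" "poly (pderiv P) z \<noteq> 0"
  shows "order z (P - [:poly P z:]) = 1"
proof -
  have "P - [:poly P z:] \<noteq> 0"
    using assms(1) by (metis degree_pCons_0 eq_iff_diff_eq_0 less_irrefl)
  then show ?thesis
    using assms(2) by (simp add: order_pderiv pderiv_diff pderiv_pCons order_0I)
qed

lemma fibre_finite:
  fixes P :: "complex poly"
  assumes "0 < degree P"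
  shows "finite {z. poly P z = y}"
proof -
  have "P - [:y:] \<noteq> 0"
    using assms by (metis degree_pCons_0 eq_iff_diff_eq_0 less_irrefl)
  then have "finite {z. poly (P - [:y:]) z = 0}"
    by (rule poly_roots_finite)
  then show ?thesis by simp
qed

text \<open>Turns vertex degrees into multiplicities in \<open>proots\<close>, whose size over the
  complex numbers is the degree.\<close>

lemma degree_partition_eq:
  fixes P :: "complex poly"
  assumes "0 < degree P"
  shows "degree_partition P y =
    image_mset (count (proots (P - [:y:]))) (mset_set (set_mset (proots (P - [:y:]))))"
proof -
  have nz: "P - [:y:] \<noteq> 0"
    using assms by (metis degree_pCons_0 eq_iff_diff_eq_0 less_irrefl)
  show ?thesis
    unfolding degree_partition_def vertices_def vertex_degree_def
    using nz fibre_finite[OF assms, of y] by (auto intro!: image_mset_cong)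
qed

lemma sum_mset_degree_partition:
  fixes P :: "complex poly"
  assumes "0 < degree P"
  shows "\<Sum>\<^sub># (degree_partition P y) = degree P"
proof -
  have "\<Sum>\<^sub># (degree_partition P y) = size (proots (P - [:y:]))"
    unfolding degree_partition_eq[OF assms]
    by (simp add: size_multiset_overloaded_eq sum_unfold_sum_mset)
  also have "\<dots> = degree (P - [:y:])" by (rule size_proots_complex)
  also have "\<dots> = degree P"
    unfolding diff_conv_add_uminus by (rule degree_add_eq_left) (use assms in simp)
  finally show ?thesis .
qed

text \<open>Off the critical values every root of \<open>P - [:y:]\<close> is simple, so the count
  with multiplicity is a count of points.\<close>

lemma card_noncritical_fibre:
  fixes P :: "complex poly"
  assumes deg: "0 < degree P" and y: "y \<notin> critical_values P"
  shows "card {z. poly P z = y} = degree P"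
proof -
  have "vertex_degree P z = 1" if "poly P z = y" for z
    unfolding vertex_degree_def using y that
    by (intro order_noncritical deg) (auto simp: critical_values_def)
  then have "degree_partition P y = image_mset (\<lambda>_. 1) (mset_set (vertices P y))"
    unfolding degree_partition_def
    by (intro image_mset_cong) (use fibre_finite[OF deg] in \<open>auto simp: vertices_def\<close>)
  then have "\<Sum>\<^sub># (degree_partition P y) = card (vertices P y)"
    by (simp add: sum_unfold_sum_mset[symmetric])
  then show ?thesis
    by (simp add: sum_mset_degree_partition[OF deg] vertices_def)
qed

section \<open>Covering property and its consequences over convex sets\<close>

text \<open>Phrased for all small radii, so that it can be combined with other conditions on the
  radius.\<close>

lemma eventually_disjoint_balls:
  fixes A :: "'a::euclidean_space set"
  assumes "finite A"
  shows "\<forall>\<^sub>F d in at_right 0. \<forall>z\<in>A. \<forall>z'\<in>A. z \<noteq> z' \<longrightarrow> ball z d \<inter> ball z' d = {}"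
proof (intro eventually_ball_finite assms ballI)
  fix z z' assume "z \<in> A" "z' \<in> A"
  have "ball z d \<inter> ball z' d = {}" if "z \<noteq> z'" "d < dist z z' / 2" for d
    using that by (intro disjoint_ballI) simp
  then show "\<forall>\<^sub>F d in at_right 0. z \<noteq> z' \<longrightarrow> ball z d \<inter> ball z' d = {}"
    unfolding eventually_at_right_field
    by (intro exI[of _ "if z = z' then 1 else dist z z' / 2"]) auto
qed

text \<open>Small disjoint discs around the fibre points are mapped injectively onto open sets.
  Since all fibres over \<open>S\<close> have the same size, no further sheets appear over the
  intersection of these images.\<close>

lemma poly_covering_space:
  fixes P :: "complex poly"
  assumes deg: "0 < degree P" and S: "S \<inter> critical_values P = {}"
  shows "covering_space {z. poly P z \<in> S} (poly P) S"
proof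
  have hol: "poly P holomorphic_on A" for A by (intro holomorphic_intros)
  show "continuous_on {z. poly P z \<in> S} (poly P)" by (intro continuous_intros)
  show "poly P ` {z. poly P z \<in> S} = S"
  proof -
    have "\<exists>z. poly P z = y" if "y \<in> S" for y
      using card_noncritical_fibre[OF deg, of y] S that deg
      by (metis (mono_tags, lifting) IntI card.empty empty_Collect_eq empty_iff less_irrefl)
    then show ?thesis by (auto simp: image_iff)
  qed
  fix x assume x: "x \<in> S"
  define A where "A = {z. poly P z = x}"
  have finA: "finite A" unfolding A_def by (rule fibre_finite[OF deg])
  have cardA: "card {z. poly P z = y} = card A" if "y \<in> S" for y
    unfolding A_def using card_noncritical_fibre[OF deg] S x that by (metis IntI empty_iff)
  have "\<forall>\<^sub>F d in at_right 0. \<forall>z\<in>A. inj_on (poly P) (ball z d)"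
  proof (intro eventually_ball_finite finA ballI)
    fix z assume "z \<in> A"
    then have "deriv (poly P) z \<noteq> 0"
      using x S by (auto simp: A_def critical_values_def DERIV_imp_deriv[OF poly_DERIV])
    then obtain r where "r > 0" "inj_on (poly P) (ball z r)"
      using has_complex_derivative_locally_injective[OF hol _ open_UNIV] by (metis UNIV_I)
    then show "\<forall>\<^sub>F d in at_right 0. inj_on (poly P) (ball z d)"
      unfolding eventually_at_right_field
      by (meson less_imp_le inj_on_subset subset_ball)
  qed
  moreover have "\<forall>\<^sub>F d in at_right 0. \<forall>z\<in>A. \<forall>z'\<in>A. z \<noteq> z' \<longrightarrow> disjnt (ball z d) (ball z' d)"
    unfolding disjnt_def by (rule eventually_disjoint_balls[OF finA])
  moreover have "\<forall>\<^sub>F d in at_right (0::real). d > 0" by (rule eventually_at_right_less)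
  ultimately have "\<forall>\<^sub>F d in at_right 0. d > 0 \<and> (\<forall>z\<in>A. inj_on (poly P) (ball z d))
      \<and> (\<forall>z\<in>A. \<forall>z'\<in>A. z \<noteq> z' \<longrightarrow> disjnt (ball z d) (ball z' d))"
    by eventually_elim auto
  then obtain d where d: "d > 0" "\<And>z. z \<in> A \<Longrightarrow> inj_on (poly P) (ball z d)"
      and dis: "\<And>z z'. z \<in> A \<Longrightarrow> z' \<in> A \<Longrightarrow> z \<noteq> z' \<Longrightarrow> disjnt (ball z d) (ball z' d)"
    using eventually_happens'[OF trivial_limit_at_right_real] by blast
  \<comment> \<open>Over \<open>T\<close> every disc contains a preimage; the sheets in
    \<open>V\<close> are the parts of the discs lying over \<open>T\<close>.\<close>
  define T where "T = S \<inter> (\<Inter>z\<in>A. poly P ` ball z d)"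
  have opn: "open (poly P ` ball z d)" if "z \<in> A" for z
    by (rule open_mapping_thm3[OF hol open_ball d(2)[OF that]])
  define V where "V = (\<lambda>z. ball z d \<inter> poly P -` T) ` A"
  have "x \<in> T" using x d(1) by (auto simp: T_def A_def)
  moreover have "openin (top_of_set S) T"
    unfolding T_def by (intro openin_open_Int open_INT finA ballI opn)
  moreover have "\<Union>V = {z. poly P z \<in> S} \<inter> poly P -` T"
  proof -
    \<comment> \<open>One preimage of \<open>poly P y\<close> in each disc makes
      \<open>card A\<close> distinct ones. The fibre has no more, so \<open>y\<close> is among
      them.\<close>
    have "\<exists>z\<in>A. y \<in> ball z d" if y: "poly P y \<in> T" for y
    proof -
      obtain h where h: "\<And>z. z \<in> A \<Longrightarrow> h z \<in> ball z d" "\<And>z. z \<in> A \<Longrightarrow> poly P (h z) = poly P y"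
      proof -
        have "\<forall>z\<in>A. \<exists>u. u \<in> ball z d \<and> poly P u = poly P y"
          using y by (fastforce simp: T_def)
        then show ?thesis using that by metis
      qed
      have "inj_on h A"
        using h(1) dis unfolding inj_on_def disjnt_iff by metis
      then have "h ` A = {z. poly P z = poly P y}"
        using h(2) y cardA by (intro card_subset_eq fibre_finite deg) (auto simp: card_image T_def)
      then have "y \<in> h ` A" by simp
      then show ?thesis using h(1) by blast
    qed
    then show ?thesis by (auto simp: V_def T_def)
  qed
  moreover have "openin (top_of_set {z. poly P z \<in> S}) u" if u: "u \<in> V" for u
  proof -
    obtain z where z: "z \<in> A" "u = ball z d \<inter> poly P -` T" using u by (auto simp: V_def)
    have "u = {z. poly P z \<in> S} \<inter> (ball z d \<inter> poly P -` (\<Inter>z\<in>A. poly P ` ball z d))"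
      by (auto simp: z T_def)
    moreover have "open (poly P -` (\<Inter>z\<in>A. poly P ` ball z d))"
      by (intro open_vimage open_INT finA ballI opn continuous_intros)
    ultimately show ?thesis by (metis openin_open_Int open_Int open_ball)
  qed
  moreover have "pairwise disjnt V"
    using dis unfolding V_def pairwise_def disjnt_def by fast
  moreover have "\<exists>q. homeomorphism u T (poly P) q" if u: "u \<in> V" for u
  proof -
    obtain z where z: "z \<in> A" "u = ball z d \<inter> poly P -` T" using u by (auto simp: V_def)
    obtain g where g: "g holomorphic_on (poly P ` ball z d)" "\<And>y. y \<in> ball z d \<Longrightarrow> g (poly P y) = y"
      using holomorphic_has_inverse[OF hol open_ball d(2)[OF z(1)]] by metis
    have sub: "T \<subseteq> poly P ` ball z d" using z(1) by (auto simp: T_def)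
    have "homeomorphism u T (poly P) g"
    proof (rule homeomorphismI)
      show "continuous_on T g" 
        using g(1) sub holomorphic_on_imp_continuous_on continuous_on_subset by blast
      show "g ` T \<subseteq> u" using sub g(2) unfolding z by fastforce
      show "poly P (g y) = y" if "y \<in> T" for y using sub g(2) that by fastforce
    qed (use z g(2) in \<open>auto intro!: continuous_intros\<close>)
    then show ?thesis by blast
  qed
  ultimately show "\<exists>T. x \<in> T \<and> openin (top_of_set S) T \<and>
         (\<exists>v. \<Union>v = {z. poly P z \<in> S} \<inter> poly P -` T \<and>
              (\<forall>u\<in>v. openin (top_of_set {z. poly P z \<in> S}) u) \<and>
              pairwise disjnt v \<and> (\<forall>u\<in>v. \<exists>q. homeomorphism u T (poly P) q))"
    by (intro exI[of _ T] exI[of _ V] conjI) auto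
qed

text \<open>A convex set is simply connected, so its identity map lifts through the covering. The
  lift stays in one component and inverts \<open>poly P\<close> there.\<close>

lemma component_section:
  fixes P :: "complex poly"
  assumes deg: "0 < degree P" and S: "S \<inter> critical_values P = {}" and "convex S"
    and e: "e \<in> components {z. poly P z \<in> S}"
  obtains g where "homeomorphism e S (poly P) g"
proof -
  let ?F = "{z. poly P z \<in> S}"
  have cov: "covering_space ?F (poly P) S" by (rule poly_covering_space[OF deg S])
  obtain a where a: "a \<in> e" using e in_components_nonempty by blast
  have eF: "e \<subseteq> ?F" using e by (rule in_components_subset)
  then have aF: "a \<in> ?F" using a by blast
  obtain g where g: "continuous_on S g" "g \<in> S \<rightarrow> ?F" "g (poly P a) = a"
      "\<And>y. y \<in> S \<Longrightarrow> poly P (g y) = y"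
  proof (rule covering_space_lift_strong[OF cov aF])
    show "poly P a \<in> S" using aF by simp
    show "simply_connected S" using \<open>convex S\<close> by (rule convex_imp_simply_connected)
    show "locally path_connected S" using \<open>convex S\<close> by (rule convex_imp_locally_path_connected)
  qed (use that in \<open>auto intro: continuous_on_id\<close>)
  have "connected (g ` S)"
    using g(1) \<open>convex S\<close> by (intro connected_continuous_image convex_connected)
  then have gS: "g ` S \<subseteq> e"
  proof (rule components_maximal[OF e])
    show "g ` S \<subseteq> ?F" using g(2) by blast
    have "a \<in> g ` S" using g(3) aF by (metis imageI mem_Collect_eq)
    then show "e \<inter> g ` S \<noteq> {}" using a by blast
  qed
  have contg: "continuous_on e (\<lambda>z. g (poly P z))"
    by (rule continuous_on_compose2[OF g(1)]) (use eF in \<open>auto intro!: continuous_intros\<close>)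
  \<comment> \<open>Both \<open>\<lambda>z. g (poly P z)\<close> and the identity lift
    \<open>poly P\<close> on the connected set \<open>e\<close> and agree at \<open>a\<close>, so
    they coincide.\<close>
  have geq: "g (poly P z) = z" if "z \<in> e" for z
  proof (rule covering_space_lift_unique[OF cov, where T = e and f = "poly P" and a = a and x = z
        and ?g1.0 = "\<lambda>z. g (poly P z)" and ?g2.0 = "\<lambda>z. z"])
    show "continuous_on e (poly P)" by (intro continuous_intros)
    show "connected e" using e by (rule in_components_connected)
  qed (use g a eF that contg in auto)
  have "homeomorphism e S (poly P) g"
    by (rule homeomorphismI) (use g eF gS geq in \<open>auto intro!: continuous_intros\<close>)
  then show ?thesis using that by blast
qed

text \<open>By the section, each component contains exactly one point over a fixed \<open>y\<close>,
  so the components correspond to a noncritical fibre.\<close>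

lemma card_components:
  fixes P :: "complex poly"
  assumes deg: "0 < degree P" and S: "S \<inter> critical_values P = {}" and "convex S" "S \<noteq> {}"
  shows "card (components {z. poly P z \<in> S}) = degree P"
proof -
  let ?F = "{z. poly P z \<in> S}"
  obtain y where y: "y \<in> S" using assms(4) by blast
  have "\<exists>!z. z \<in> e \<and> poly P z = y" if e: "e \<in> components ?F" for e
  proof -
    obtain g where "homeomorphism e S (poly P) g"
      using component_section[OF deg S assms(3) e] .
    then have "g y \<in> e" "poly P (g y) = y" "\<And>z. z \<in> e \<Longrightarrow> g (poly P z) = z"
      using y by (auto simp: homeomorphism_def)
    then show ?thesis by (intro ex1I[of _ "g y"]) auto
  qed
  then obtain h where h: "\<And>e. e \<in> components ?F \<Longrightarrow> h e \<in> e \<and> poly P (h e) = y"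
      "\<And>e z. e \<in> components ?F \<Longrightarrow> z \<in> e \<Longrightarrow> poly P z = y \<Longrightarrow> z = h e"
    by metis
  have "bij_betw h (components ?F) {z. poly P z = y}"
  proof (rule bij_betw_imageI)
    show "inj_on h (components ?F)"
    proof (rule inj_onI)
      fix e e' assume e: "e \<in> components ?F" "e' \<in> components ?F" and "h e = h e'"
      then have "h e \<in> e \<inter> e'" using h(1) by (metis IntI)
      then show "e = e'" using components_eq[OF e] by blast
    qed
    show "h ` components ?F = {z. poly P z = y}"
    proof safe
      fix e assume "e \<in> components ?F" then show "poly P (h e) = y" using h(1) by blast
    next
      fix z assume "y = poly P z"
      then obtain e where "e \<in> components ?F" "z \<in> e"
        using y by (metis UnionE Union_components mem_Collect_eq)
      then show "z \<in> h ` components ?F" using h(2) \<open>y = poly P z\<close> by blast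
    qed
  qed
  then show ?thesis
    using card_noncritical_fibre[OF deg, of y] y S by (metis IntI bij_betw_same_card empty_iff)
qed

section \<open>Limits of lifts at the ends of the segment\<close>

text \<open>In the factorisation of \<open>P - [:c:]\<close>, distance at least
  \<open>\<epsilon>\<close> from every root forces a value of norm at least
  \<open>norm (lead_coeff Q) * \<epsilon> ^ degree Q\<close>; this is the choice of
  \<open>\<delta>\<close>.\<close>

lemma near_fibre:
  fixes P :: "complex poly"
  assumes "0 < degree P" "0 < \<epsilon>"
  obtains \<delta> where "0 < \<delta>" "\<And>z. dist (poly P z) c < \<delta> \<Longrightarrow> \<exists>v. poly P v = c \<and> dist z v < \<epsilon>"
proof -
  define Q where "Q = P - [:c:]"
  have "Q \<noteq> 0"
    using assms(1) by (metis Q_def degree_pCons_0 eq_iff_diff_eq_0 less_irrefl)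
  obtain root where dec: "smult (lead_coeff Q) (\<Prod>i<degree Q. [:-root i, 1:]) = Q"
    by (rule complex_poly_decompose')
  have ev: "poly P z - c = lead_coeff Q * (\<Prod>i<degree Q. z - root i)" for z
    using arg_cong[OF dec, of "\<lambda>q. poly q z"] by (simp add: poly_prod Q_def)
  show ?thesis
  proof
    show "0 < norm (lead_coeff Q) * \<epsilon> ^ degree Q" using \<open>Q \<noteq> 0\<close> assms(2) by simp
    fix z assume z: "dist (poly P z) c < norm (lead_coeff Q) * \<epsilon> ^ degree Q"
    show "\<exists>v. poly P v = c \<and> dist z v < \<epsilon>"
    proof (rule ccontr)
      assume H: "\<not> ?thesis"
      have "\<epsilon> \<le> norm (z - root i)" if "i < degree Q" for i
      proof -
        have "poly P (root i) - c = 0" unfolding ev using that by (auto simp: prod_zero_iff)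
        then show ?thesis using H by (force simp: dist_norm)
      qed
      then have "(\<Prod>i<degree Q. \<epsilon>) \<le> (\<Prod>i<degree Q. norm (z - root i))"
        using assms(2) by (intro prod_mono) auto
      then have "norm (lead_coeff Q) * \<epsilon> ^ degree Q \<le> dist (poly P z) c"
        by (simp add: dist_norm ev norm_mult prod_norm mult_left_mono)
      then show False using z by simp
    qed
  qed
qed

text \<open>Here \<open>c\<close> may be a critical value, where the covering argument fails.
  Instead, the curve comes close to the finite fibre over \<open>c\<close>, and by connectedness it
  stays near a single point of it.\<close>

lemma lift_limit:
  fixes P :: "complex poly" and f :: "real \<Rightarrow> complex"
  assumes deg: "0 < degree P" and cont: "continuous_on {0<..<1} f"
    and lim: "((\<lambda>t. poly P (f t)) \<longlongrightarrow> c) (at_right 0)"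
  obtains v where "poly P v = c" "(f \<longlongrightarrow> v) (at_right 0)"
proof -
  define A where "A = {z. poly P z = c}"
  have finA: "finite A" unfolding A_def by (rule fibre_finite[OF deg])
  have near: "\<forall>\<^sub>F t in at_right 0. \<exists>v\<in>A. f t \<in> ball v \<epsilon>" if \<epsilon>: "\<epsilon> > 0" for \<epsilon>
  proof -
    obtain \<delta> where "0 < \<delta>" "\<And>z. dist (poly P z) c < \<delta> \<Longrightarrow> \<exists>v. poly P v = c \<and> dist z v < \<epsilon>"
      using near_fibre[OF deg \<epsilon>] by blast
    moreover from this have "\<forall>\<^sub>F t in at_right 0. dist (poly P (f t)) c < \<delta>"
      using lim by (simp add: tendsto_iff)
    ultimately show ?thesis
      unfolding A_def mem_ball by (auto elim!: eventually_mono) (metis dist_commute)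
  qed
  have "\<exists>\<epsilon>>0. \<forall>z\<in>A. \<forall>z'\<in>A. z \<noteq> z' \<longrightarrow> ball z \<epsilon> \<inter> ball z' \<epsilon> = {}"
  proof -
    note eventually_disjoint_balls[OF finA]
    moreover have "\<forall>\<^sub>F d in at_right (0::real). d > 0" by (rule eventually_at_right_less)
    ultimately have "\<forall>\<^sub>F d in at_right 0. d > 0 \<and> (\<forall>z\<in>A. \<forall>z'\<in>A. z \<noteq> z' \<longrightarrow> ball z d \<inter> ball z' d = {})"
      by eventually_elim auto
    then show ?thesis using eventually_happens'[OF trivial_limit_at_right_real] by blast
  qed
  then obtain \<epsilon>0 where \<epsilon>0: "\<epsilon>0 > 0"
      and dis: "\<And>z z'. z \<in> A \<Longrightarrow> z' \<in> A \<Longrightarrow> z \<noteq> z' \<Longrightarrow> ball z \<epsilon>0 \<inter> ball z' \<epsilon>0 = {}"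
    by blast
  obtain b where b: "b > 0" "\<And>t. 0 < t \<Longrightarrow> t < b \<Longrightarrow> \<exists>v\<in>A. f t \<in> ball v \<epsilon>0"
    using near[OF \<epsilon>0] unfolding eventually_at_right_field by blast
  define \<eta> where "\<eta> = min b 1"
  have \<eta>: "0 < \<eta>" "\<eta> \<le> 1" "\<eta> \<le> b" using b by (auto simp: \<eta>_def)
  obtain v where v: "v \<in> A" "f (\<eta> / 2) \<in> ball v \<epsilon>0" using b(2)[of "\<eta> / 2"] \<eta> by auto
  have conn: "connected (f ` {0<..<\<eta>})"
    by (intro connected_continuous_image continuous_on_subset[OF cont]) (use \<eta> in auto)
  have in_v: "f t \<in> ball v \<epsilon>0" if t: "0 < t" "t < \<eta>" for t
  proof (rule ccontr)
    assume "f t \<notin> ball v \<epsilon>0"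
    then obtain v' where v': "v' \<in> A - {v}" "f t \<in> ball v' \<epsilon>0" using b(2)[of t] t \<eta> by auto
    \<comment> \<open>The ball around \<open>v\<close> and the union of the other balls would
      disconnect the image of the initial interval.\<close>
    let ?U = "\<Union>u\<in>A - {v}. ball u \<epsilon>0"
    have 1: "f t \<in> ?U \<inter> f ` {0<..<\<eta>}" using v' t by (intro IntI UN_I[of v'] imageI) auto
    have 2: "f (\<eta> / 2) \<in> ball v \<epsilon>0 \<inter> f ` {0<..<\<eta>}" using v \<eta> by (intro IntI imageI) auto
    have 3: "f ` {0<..<\<eta>} \<subseteq> ball v \<epsilon>0 \<union> ?U"
    proof (rule image_subsetI)
      fix t assume "t \<in> {0<..<\<eta>}"
      then obtain u where "u \<in> A" "f t \<in> ball u \<epsilon>0" using b(2)[of t] \<eta> by auto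
      then show "f t \<in> ball v \<epsilon>0 \<union> ?U" by (cases "u = v") blast+
    qed
    have "ball v \<epsilon>0 \<inter> ball u \<epsilon>0 = {}" if "u \<in> A - {v}" for u
      using dis[OF v(1)] that by blast
    then have 4: "ball v \<epsilon>0 \<inter> ?U \<inter> f ` {0<..<\<eta>} = {}" by blast
    have "open ?U" by auto
    then show False
      using connectedD[OF conn open_ball _ 4 3] 1 2 by (metis empty_iff)
  qed
  have "(f \<longlongrightarrow> v) (at_right 0)"
  proof (rule tendstoI)
    fix \<epsilon> :: real assume "\<epsilon> > 0"
    \<comment> \<open>The radius is capped by \<open>\<epsilon>0\<close> so that the nearby fibre
      point can only be \<open>v\<close>.\<close>
    then have "\<forall>\<^sub>F t in at_right 0. \<exists>u\<in>A. f t \<in> ball u (min \<epsilon> \<epsilon>0)" using \<epsilon>0 by (intro near) simp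
    moreover have "\<forall>\<^sub>F t in at_right 0. 0 < t \<and> t < \<eta>"
      using \<eta> unfolding eventually_at_right_field by auto
    ultimately show "\<forall>\<^sub>F t in at_right 0. dist (f t) v < \<epsilon>"
    proof eventually_elim
      case (elim t)
      then obtain u where u: "u \<in> A" "dist u (f t) < \<epsilon>" "dist u (f t) < \<epsilon>0" by auto
      moreover have "f t \<in> ball v \<epsilon>0" using elim in_v by blast
      ultimately have "f t \<in> ball u \<epsilon>0 \<inter> ball v \<epsilon>0" by simp
      then have "u = v" using dis[OF u(1) v(1)] by blast
      then show ?case using u by (simp add: dist_commute)
    qed
  qed
  then show ?thesis using that v(1) by (simp add: A_def)
qed

subsection \<open>Edges of the tree\<close>

locale shabat_polynomial =
  fixes P :: "complex poly" and c1 c2 :: complex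
  assumes shabat: "shabat P c1 c2"
begin

lemma deg: "0 < degree P" and ends_distinct: "c1 \<noteq> c2" and crit: "critical_values P \<subseteq> {c1, c2}"
  using shabat by (auto simp: shabat_def)

lemma linepath_inj:
  assumes "linepath c1 c2 s = linepath c1 c2 t"
  shows "s = t"
proof -
  have "linepath c1 c2 s - linepath c1 c2 t = of_real (s - t) * (c2 - c1)"
    by (simp add: linepath_def scaleR_conv_of_real algebra_simps)
  then show ?thesis using assms ends_distinct by simp
qed

lemma segment_noncritical: "open_segment c1 c2 \<inter> critical_values P = {}"
  using crit by (auto simp: open_segment_def)

lemma card_edges: "card (edges P c1 c2) = degree P"
  unfolding edges_def
  using ends_distinct by (intro card_components deg segment_noncritical convex_open_segment) auto

lemma edge_section:
  assumes "e \<in> edges P c1 c2"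
  obtains g where "homeomorphism e (open_segment c1 c2) (poly P) g"
  by (rule component_section[OF deg segment_noncritical convex_open_segment assms[unfolded edges_def]])
    (rule that)

lemma edge_inj:
  assumes "e \<in> edges P c1 c2"
  shows "inj_on (poly P) e"
proof -
  obtain g where "homeomorphism e (open_segment c1 c2) (poly P) g" using edge_section[OF assms] .
  then show ?thesis by (intro inj_on_inverseI[of _ g]) (auto simp: homeomorphism_def)
qed

lemma edges_disjoint:
  "e \<in> edges P c1 c2 \<Longrightarrow> e' \<in> edges P c1 c2 \<Longrightarrow> z \<in> e \<Longrightarrow> z \<in> e' \<Longrightarrow> e = e'"
  unfolding edges_def using components_eq by blast

text \<open>The section over the open segment extends continuously to both ends by
  \<open>lift_limit\<close>. The extended curve is injective because \<open>poly P\<close> maps it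
  to the injective \<open>linepath\<close>.\<close>

lemma edge_arc:
  assumes e: "e \<in> edges P c1 c2"
  obtains \<gamma> where "arc \<gamma>" "\<And>t. t \<in> {0..1} \<Longrightarrow> poly P (\<gamma> t) = linepath c1 c2 t"
    "e = \<gamma> ` {0<..<1}" "closure e = path_image \<gamma>"
proof -
  obtain g where g: "homeomorphism e (open_segment c1 c2) (poly P) g" using edge_section[OF e] .
  define h where "h = (\<lambda>t. g (linepath c1 c2 t))"
  have seg: "linepath c1 c2 ` {0<..<1} = open_segment c1 c2"
    unfolding open_segment_image_interval using ends_distinct by (simp add: linepath_def)
  have conth: "continuous_on {0<..<1} h"
    unfolding h_def
    by (rule continuous_on_compose2[of "open_segment c1 c2" g])
      (use g seg in \<open>auto simp: homeomorphism_def intro!: continuous_intros\<close>)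
  have Ph: "poly P (h t) = linepath c1 c2 t" if "t \<in> {0<..<1}" for t
    using g seg that unfolding h_def homeomorphism_def by blast
  have eh: "e = h ` {0<..<1}"
    using g seg unfolding h_def homeomorphism_def by (metis image_image)
  have lim_line: "((\<lambda>t. linepath c1 c2 t) \<longlongrightarrow> linepath c1 c2 a) (at a within S)" for a S
    using continuous_linepath_at[of a c1 c2] by (simp add: continuous_at tendsto_within_subset[of _ _ a UNIV])
  obtain v where v: "poly P v = c1" "(h \<longlongrightarrow> v) (at_right 0)"
  proof (rule lift_limit[OF deg conth])
    have "((\<lambda>t. linepath c1 c2 t) \<longlongrightarrow> c1) (at_right 0)"
      using lim_line[of 0] by (simp add: linepath_def)
    then show "((\<lambda>t. poly P (h t)) \<longlongrightarrow> c1) (at_right 0)"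
    proof (rule Lim_transform_eventually)
      show "\<forall>\<^sub>F t in at_right 0. linepath c1 c2 t = poly P (h t)"
        unfolding eventually_at_right_field using Ph by (intro exI[of _ 1]) auto
    qed
  qed
  \<comment> \<open>The end at parameter \<open>1\<close> is reduced to the one at \<open>0\<close>
    by reversing the parameter.\<close>
  obtain w where w: "poly P w = c2" "(h \<longlongrightarrow> w) (at_left 1)"
  proof -
    have "continuous_on {0<..<1} (\<lambda>t. h (1 - t))"
      by (rule continuous_on_compose2[OF conth]) (auto intro!: continuous_intros)
    moreover have "((\<lambda>t. poly P (h (1 - t))) \<longlongrightarrow> c2) (at_right 0)"
    proof (rule Lim_transform_eventually)
      show "((\<lambda>t. linepath c2 c1 t) \<longlongrightarrow> c2) (at_right 0)"
        unfolding linepath_def by (auto intro!: tendsto_eq_intros)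
      show "\<forall>\<^sub>F t in at_right 0. linepath c2 c1 t = poly P (h (1 - t))"
        unfolding eventually_at_right_field
      proof (intro exI[of _ 1] conjI allI impI)
        fix t :: real assume "0 < t" "t < 1"
        then show "linepath c2 c1 t = poly P (h (1 - t))"
          by (subst Ph) (auto simp: linepath_def)
      qed simp
    qed
    ultimately obtain w where w: "poly P w = c2" "((\<lambda>t. h (1 - t)) \<longlongrightarrow> w) (at_right 0)"
      by (rule lift_limit[OF deg])
    have "filterlim (\<lambda>t::real. 1 - t) (at_right 0) (at_left 1)"
      unfolding filterlim_at by (auto intro!: tendsto_eq_intros eventually_at_leftI[of 0])
    from filterlim_compose[OF w(2) this] have "(h \<longlongrightarrow> w) (at_left 1)" by simp
    with w(1) show ?thesis using that by blast
  qed
  define \<gamma> where "\<gamma> = (\<lambda>t. if t = 0 then v else if t = 1 then w else h t)"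
  have \<gamma>h: "\<gamma> t = h t" if "t \<in> {0<..<1}" for t using that by (simp add: \<gamma>_def)
  have P\<gamma>: "poly P (\<gamma> t) = linepath c1 c2 t" if "t \<in> {0..1}" for t
    using that Ph[of t] v(1) w(1) by (auto simp: \<gamma>_def linepath_def)
  have cont: "continuous_on {0..1} \<gamma>"
  proof (rule continuous_on_IccI)
    show "(\<gamma> \<longlongrightarrow> \<gamma> 0) (at_right 0)"
    proof (rule Lim_transform_eventually[of h])
      show "(h \<longlongrightarrow> \<gamma> 0) (at_right 0)" using v(2) by (simp add: \<gamma>_def)
      show "\<forall>\<^sub>F t in at_right 0. h t = \<gamma> t"
        unfolding eventually_at_right_field using \<gamma>h by (intro exI[of _ 1]) auto
    qed
    show "(\<gamma> \<longlongrightarrow> \<gamma> 1) (at_left 1)"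
    proof (rule Lim_transform_eventually[of h])
      show "(h \<longlongrightarrow> \<gamma> 1) (at_left 1)" using w(2) by (simp add: \<gamma>_def)
      show "\<forall>\<^sub>F t in at_left 1. h t = \<gamma> t"
        unfolding eventually_at_left_field using \<gamma>h by (intro exI[of _ 0]) auto
    qed
    fix x :: real assume x: "0 < x" "x < 1"
    show "(\<gamma> \<longlongrightarrow> \<gamma> x) (at x)"
    proof (rule Lim_transform_within_open[of h _ x UNIV "{0<..<1}"])
      show "(h \<longlongrightarrow> \<gamma> x) (at x)"
        using conth x \<gamma>h[of x] by (simp add: continuous_on_eq_continuous_at continuous_at)
    qed (use x \<gamma>h in auto)
  qed simp
  have inj: "inj_on \<gamma> {0..1}"
  proof (rule inj_onI)
    fix s t assume "s \<in> {0..1}" "t \<in> {0..1}" "\<gamma> s = \<gamma> t"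
    then have "linepath c1 c2 s = linepath c1 c2 t" using P\<gamma> by metis
    then show "s = t" by (rule linepath_inj)
  qed
  have arc: "arc \<gamma>" using cont inj by (simp add: arc_def path_def)
  have e\<gamma>: "e = \<gamma> ` {0<..<1}" unfolding eh using \<gamma>h by (auto simp: image_iff)
  have "closure e = path_image \<gamma>"
  proof
    show "closure e \<subseteq> path_image \<gamma>"
      by (intro closure_minimal closed_path_image arc_imp_path arc) (auto simp: e\<gamma> path_image_def)
    have "\<gamma> ` closure {0<..<1} \<subseteq> closure e"
      using cont by (intro image_closure_subset) (simp_all add: e\<gamma> closure_subset)
    then show "path_image \<gamma> \<subseteq> closure e" by (simp add: path_image_def)
  qed
  with that arc P\<gamma> e\<gamma> show ?thesis by blast
qed

text \<open>A closed curve in the preimage of the segment would bound a region on whose frontier, hence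
  also inside, the affinely normalised polynomial is real.\<close>

lemma edges_common_ends:
  assumes e: "e \<in> edges P c1 c2" "e' \<in> edges P c1 c2"
    and v: "poly P v = c1" "v \<in> closure e" "v \<in> closure e'"
    and w: "poly P w = c2" "w \<in> closure e" "w \<in> closure e'"
  shows "e = e'"
proof (rule ccontr)
  assume "e \<noteq> e'"
  obtain \<gamma> where \<gamma>: "arc \<gamma>" "\<And>t. t \<in> {0..1} \<Longrightarrow> poly P (\<gamma> t) = linepath c1 c2 t"
    "e = \<gamma> ` {0<..<1}" "closure e = path_image \<gamma>" using edge_arc[OF e(1)] by blast
  obtain \<delta> where \<delta>: "arc \<delta>" "\<And>t. t \<in> {0..1} \<Longrightarrow> poly P (\<delta> t) = linepath c1 c2 t"
    "e' = \<delta> ` {0<..<1}" "closure e' = path_image \<delta>" using edge_arc[OF e(2)] by blast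
  note inj = linepath_inj
  have start: "\<alpha> 0 = v" if "\<And>t. t \<in> {0..1} \<Longrightarrow> poly P (\<alpha> t) = linepath c1 c2 t" "v \<in> path_image \<alpha>" for \<alpha>
  proof -
    obtain t where t: "t \<in> {0..1}" "v = \<alpha> t" using \<open>v \<in> path_image \<alpha>\<close> by (auto simp: path_image_def)
    then have "linepath c1 c2 t = linepath c1 c2 0" using that(1)[of t] v(1) by (simp add: linepath_0')
    then show ?thesis using inj t by blast
  qed
  have fin: "\<alpha> 1 = w" if "\<And>t. t \<in> {0..1} \<Longrightarrow> poly P (\<alpha> t) = linepath c1 c2 t" "w \<in> path_image \<alpha>" for \<alpha>
  proof -
    obtain t where t: "t \<in> {0..1}" "w = \<alpha> t" using \<open>w \<in> path_image \<alpha>\<close> by (auto simp: path_image_def)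
    then have "linepath c1 c2 t = linepath c1 c2 1" using that(1)[of t] w(1) by (simp add: linepath_1')
    then show ?thesis using inj t by blast
  qed
  note start = start[OF \<gamma>(2) v(2)[unfolded \<gamma>(4)]] start[OF \<delta>(2) v(3)[unfolded \<delta>(4)]]
  note fin = fin[OF \<gamma>(2) w(2)[unfolded \<gamma>(4)]] fin[OF \<delta>(2) w(3)[unfolded \<delta>(4)]]
  have "path_image \<gamma> \<inter> path_image \<delta> \<subseteq> {v, w}"
  proof
    \<comment> \<open>A common point has the same parameter on both arcs, as \<open>poly P\<close>
      reads it off. An interior parameter would put it in two disjoint edges.\<close>
    fix z assume "z \<in> path_image \<gamma> \<inter> path_image \<delta>"
    then obtain s t where st: "s \<in> {0..1}" "t \<in> {0..1}" "z = \<gamma> s" "z = \<delta> t"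
      by (auto simp: path_image_def)
    then have "s = t" using \<gamma>(2)[of s] \<delta>(2)[of t] inj by auto
    have "\<not> (0 < s \<and> s < 1)"
    proof
      assume "0 < s \<and> s < 1"
      then have "z \<in> e" "z \<in> e'" using st(3,4) \<open>s = t\<close> unfolding \<gamma>(3) \<delta>(3)
        by (metis greaterThanLessThan_iff imageI)+
      then show False using edges_disjoint[OF e] \<open>e \<noteq> e'\<close> by blast
    qed
    then show "z \<in> {v, w}" using st start fin by auto
  qed
  \<comment> \<open>Two arcs meeting only in their ends form a simple loop, to which the Jordan
    curve theorem applies.\<close>
  then have simple: "simple_path (\<gamma> +++ reversepath \<delta>)"
    using \<gamma>(1) \<delta>(1) start fin
    by (subst simple_path_join_loop_eq)
      (auto simp: pathstart_def pathfinish_def reversepath_def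
        arc_reversepath[unfolded reversepath_def] path_image_reversepath[unfolded reversepath_def])
  let ?L = "path_image (\<gamma> +++ reversepath \<delta>)"
  have L: "?L = path_image \<gamma> \<union> path_image \<delta>"
    using fin by (subst path_image_join)
      (auto simp: pathfinish_def pathstart_def reversepath_def path_image_reversepath[unfolded reversepath_def])
  have closed: "closed ?L"
    unfolding L using \<gamma>(1) \<delta>(1) by (intro closed_Un closed_path_image arc_imp_path)
  have "pathfinish (\<gamma> +++ reversepath \<delta>) = pathstart (\<gamma> +++ reversepath \<delta>)"
  proof -
    have "pathstart \<gamma> = pathstart \<delta>" using start by (simp add: pathstart_def)
    then show ?thesis by simp
  qed
  from Jordan_inside_outside[OF simple this]
  have I: "inside ?L \<noteq> {}" "open (inside ?L)" "bounded (inside ?L)" by auto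
  \<comment> \<open>The affine change of values takes the segment to \<open>[0,1]\<close>, so
    \<open>q\<close> is real on the loop.\<close>
  define q where "q = (\<lambda>z. (poly P z - c1) / (c2 - c1))"
  have holq: "q holomorphic_on A" for A
    unfolding q_def using ends_distinct by (intro holomorphic_intros) auto
  have real_L: "q z \<in> \<real>" if zL: "z \<in> ?L" for z
  proof -
    obtain t where "poly P z = linepath c1 c2 t"
      using zL[unfolded L] \<gamma>(2) \<delta>(2) by (auto simp: path_image_def)
    then have "poly P z - c1 = of_real t * (c2 - c1)"
      by (simp add: linepath_def scaleR_conv_of_real algebra_simps)
    then show ?thesis using ends_distinct by (simp add: q_def)
  qed
  \<comment> \<open>The norms of \<open>exp (\<i> * q z)\<close> and
    \<open>exp (- \<i> * q z)\<close> are \<open>exp (- Im (q z))\<close> and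
    \<open>exp (Im (q z))\<close>. The maximum principle for both bounds \<open>Im (q z)\<close>
    from both sides by \<open>0\<close>.\<close>
  have bound: "norm (exp (k * q z)) \<le> 1" if k: "k = \<i> \<or> k = - \<i>" and z: "z \<in> inside ?L" for k z
  proof (rule maximum_modulus_frontier[where S = "inside ?L" and f = "\<lambda>u. exp (k * q u)"])
    fix u assume "u \<in> frontier (inside ?L)"
    then have "q u \<in> \<real>" using frontier_inside_subset[OF closed] real_L by blast
    then have "Im (q u) = 0" by (simp add: complex_is_Real_iff)
    then show "norm (exp (k * q u)) \<le> 1" using k by (auto simp: norm_exp_eq_Re)
  qed (use I z in \<open>auto intro!: holomorphic_intros holq holomorphic_on_imp_continuous_on\<close>)
  have "Im (q z) = 0" if "z \<in> inside ?L" for z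
    using bound[of \<i> z] bound[of "-\<i>" z] that by (auto simp: norm_exp_eq_Re)
  then have sub: "q ` inside ?L \<subseteq> {z. Im z = 0}" by auto
  \<comment> \<open>A nonconstant \<open>q\<close> has an open image of the inside, which cannot lie
    in the real line.\<close>
  have "open (q ` inside ?L)"
  proof (rule open_mapping_thm[OF holq open_UNIV connected_UNIV I(2)])
    show "\<not> q constant_on UNIV"
    proof
      assume "q constant_on UNIV"
      then obtain c where "\<And>z. q z = c" by (auto simp: constant_on_def)
      then have "poly P z = c1 + c * (c2 - c1)" for z
        using ends_distinct by (auto simp: q_def field_simps)
      then have "{z. poly P z = c1 + c * (c2 - c1)} = UNIV" by auto
      then show False using fibre_finite[OF deg] infinite_UNIV_char_0 by metis
    qed
  qed auto
  then have "q ` inside ?L \<subseteq> interior {z. Im z = 0}" using sub by (rule interior_maximal[rotated])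
  moreover have "interior {z. Im z = 0} = {}"
    using interior_hyperplane[of "\<i>::complex" 0] by (simp add: inner_complex_def)
  ultimately show False using I(1) by auto
qed

text \<open>Near \<open>w\<close>, \<open>P - c2\<close> is the \<open>m\<close>-th power of a local coordinate \<open>\<phi>\<close>, in which the edges at \<open>w\<close>
  are \<open>m\<close> equally spaced straight rays.\<close>

lemma edge_tangents:
  assumes w: "poly P w = c2"
  obtains D \<zeta> where "norm \<zeta> = 1"
    "bij_betw D (edges_at P c1 c2 w) {d. d ^ vertex_degree P w = \<zeta>}"
    "\<And>e. e \<in> edges_at P c1 c2 w \<Longrightarrow> ((\<lambda>z. sgn (z - w)) \<longlongrightarrow> D e) (at w within e)"
proof -
  define m where "m = vertex_degree P w"
  let ?F = "{z. poly P z \<in> open_segment c1 c2}"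
  have nz: "P - [:c2:] \<noteq> 0"
    using deg by (metis degree_pCons_0 eq_iff_diff_eq_0 less_irrefl)
  obtain q where q: "P - [:c2:] = [:- w, 1:] ^ m * q" "\<not> [:- w, 1:] dvd q"
    using order_decomp[OF nz, of w] w unfolding m_def vertex_degree_def by metis
  have qw: "poly q w \<noteq> 0" using q(2) by (simp add: poly_eq_0_iff_dvd)
  have m: "m > 0"
    unfolding m_def vertex_degree_def using nz w by (simp add: order_gt_0_iff)
  have Pq: "poly P z = c2 + (z - w) ^ m * poly q z" for z
    using arg_cong[OF q(1), of "\<lambda>p. poly p z"] by (simp add: algebra_simps)
  have "open {z. poly q z \<noteq> 0}" by (intro open_Collect_neq continuous_intros)
  then obtain r0 where r0: "r0 > 0" "ball w r0 \<subseteq> {z. poly q z \<noteq> 0}"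
    by (rule openE[of _ w]) (use qw in auto)
  \<comment> \<open>The cofactor \<open>q\<close> has no zero on the ball, so it has a logarithm
    there and hence an \<open>m\<close>-th root \<open>g\<close>.\<close>
  obtain l where l: "l holomorphic_on ball w r0" "\<And>z. z \<in> ball w r0 \<Longrightarrow> poly q z = exp (l z)"
  proof -
    have "simply_connected (ball w r0)" by (intro convex_imp_simply_connected convex_ball)
    moreover have "poly q holomorphic_on ball w r0" by (intro holomorphic_intros)
    ultimately show ?thesis
      using r0 that simply_connected_eq_holomorphic_log[OF open_ball, of w r0] by blast
  qed
  define g where "g = (\<lambda>z. exp (l z / of_nat m))"
  have holg: "g holomorphic_on ball w r0"
    unfolding g_def using m by (intro holomorphic_intros l) auto
  have gnz: "g z \<noteq> 0" for z by (simp add: g_def)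
  have gm: "g z ^ m = poly q z" if "z \<in> ball w r0" for z
    using l(2)[OF that] m by (simp add: g_def flip: exp_of_nat_mult)
  \<comment> \<open>This is the local coordinate: \<open>\<phi> z ^ m\<close> is
    \<open>poly P z - c2\<close>, and \<open>\<phi>\<close> has nonzero derivative
    \<open>g w\<close> at \<open>w\<close>.\<close>
  define \<phi> where "\<phi> = (\<lambda>z. (z - w) * g z)"
  have hol\<phi>: "\<phi> holomorphic_on ball w r0"
    unfolding \<phi>_def by (intro holomorphic_intros holg)
  have "(\<phi> has_field_derivative (1 * g w + deriv g w * (w - w))) (at w)"
    unfolding \<phi>_def
    by (intro DERIV_mult derivative_eq_intros holomorphic_derivI[OF holg]) (use r0 in auto)
  then have "deriv \<phi> w \<noteq> 0" using gnz by (simp add: DERIV_imp_deriv)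
  then obtain r where r: "r > 0" "ball w r \<subseteq> ball w r0" "inj_on \<phi> (ball w r)"
    using has_complex_derivative_locally_injective[OF hol\<phi> _ open_ball, of w] r0 by (metis centre_in_ball)
  have hol\<phi>r: "\<phi> holomorphic_on ball w r" using hol\<phi> r(2) holomorphic_on_subset by blast
  have P\<phi>: "poly P z = c2 + \<phi> z ^ m" if "z \<in> ball w r" for z
    using gm[of z] that r(2) by (auto simp: Pq \<phi>_def power_mult_distrib)
  obtain \<psi> where \<psi>: "\<psi> holomorphic_on (\<phi> ` ball w r)" "\<And>z. z \<in> ball w r \<Longrightarrow> \<psi> (\<phi> z) = z"
    using holomorphic_has_inverse[OF hol\<phi>r open_ball r(3)] by metis
  have "open (\<phi> ` ball w r)" by (rule open_mapping_thm3[OF hol\<phi>r open_ball r(3)])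
  moreover have "0 \<in> \<phi> ` ball w r" using r(1) by (auto simp: \<phi>_def image_iff intro!: bexI[of _ w])
  ultimately obtain \<epsilon> where \<epsilon>: "\<epsilon> > 0" "ball 0 \<epsilon> \<subseteq> \<phi> ` ball w r"
    by (rule openE)
  \<comment> \<open>An \<open>m\<close>-th root of \<open>c1 - c2\<close>. For
    \<open>\<omega> ^ m = 1\<close> the point \<open>\<rho> * \<omega> * of_real s\<close> in the
    coordinate has value \<open>c2 + of_real (s ^ m) * (c1 - c2)\<close>, so the segment pulls back
    to rays.\<close>
  define \<rho> where "\<rho> = exp (Ln (c1 - c2) / of_nat m)"
  have \<rho>: "\<rho> ^ m = c1 - c2" "\<rho> \<noteq> 0"
    using m ends_distinct by (simp_all add: \<rho>_def flip: exp_of_nat_mult)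
  \<comment> \<open>The bound \<open>1\<close> keeps \<open>s ^ m\<close> below \<open>1\<close>,
    hence values inside the open segment; the bound \<open>\<epsilon> / norm \<rho>\<close> keeps
    the rays in the range of the coordinate.\<close>
  define \<eta> where "\<eta> = min 1 (\<epsilon> / norm \<rho>)"
  have \<eta>: "0 < \<eta>" "\<eta> \<le> 1" "\<eta> * norm \<rho> \<le> \<epsilon>"
    using \<epsilon> \<rho> by (auto simp: \<eta>_def min_def field_simps)
  let ?N = "ball (0::complex) (\<eta> * norm \<rho>)"
  have N: "?N \<subseteq> \<phi> ` ball w r" using \<eta>(3) \<epsilon>(2) by (meson order_trans subset_ball)
  define B where "B = ball w r \<inter> \<phi> -` ?N"
  have openB: "open B"
    unfolding B_def
    by (rule continuous_open_preimage) (use hol\<phi>r holomorphic_on_imp_continuous_on in auto)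
  have wB: "w \<in> B" using r(1) \<eta>(1) \<rho>(2) by (simp add: B_def \<phi>_def)
  have \<psi>N: "\<psi> u \<in> ball w r" "\<phi> (\<psi> u) = u" if "u \<in> ?N" for u
    using that N \<psi>(2) by fastforce+
  define \<Omega> where "\<Omega> = {\<omega>::complex. \<omega> ^ m = 1}"
  have norm\<Omega>: "norm \<omega> = 1" if "\<omega> \<in> \<Omega>" for \<omega>
    using that m power_eq_1_iff[of \<omega> m] by (simp add: \<Omega>_def)
  have ray_N: "\<rho> * \<omega> * of_real s \<in> ?N" if "\<omega> \<in> \<Omega>" "s \<in> {0<..<\<eta>}" for \<omega> s
    using that norm\<Omega> \<rho>(2) by (simp add: norm_mult mult.commute)
  have P_ray: "poly P (\<psi> (\<rho> * \<omega> * of_real s)) = c2 + of_real (s ^ m) * (c1 - c2)"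
    if "\<omega> \<in> \<Omega>" "s \<in> {0<..<\<eta>}" for \<omega> s
  proof -
    have "poly P (\<psi> (\<rho> * \<omega> * of_real s)) = c2 + (\<rho> * \<omega> * of_real s) ^ m"
      using P\<phi> \<psi>N ray_N[OF that] by metis
    then show ?thesis using that(1) \<rho>(1) by (simp add: power_mult_distrib \<Omega>_def)
  qed
  define R where "R = (\<lambda>\<omega>. (\<lambda>s. \<psi> (\<rho> * \<omega> * of_real s)) ` {0<..<\<eta>})"
  have R_F: "R \<omega> \<subseteq> ?F" if "\<omega> \<in> \<Omega>" for \<omega>
  proof -
    have "c2 + of_real (s ^ m) * (c1 - c2) \<in> open_segment c2 c1" if "s \<in> {0<..<\<eta>}" for s :: real
    proof -
      have "0 < s ^ m" "s ^ m < 1"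
        using that \<eta>(2) m by (auto simp: power_less_one_iff)
      then show ?thesis
        using ends_distinct unfolding in_segment
        by (intro conjI exI[of _ "s ^ m"]) (auto simp: scaleR_conv_of_real algebra_simps)
    qed
    then show ?thesis
      unfolding R_def using P_ray[OF that] by (auto simp: open_segment_commute[of c1])
  qed
  have R_conn: "connected (R \<omega>)" if "\<omega> \<in> \<Omega>" for \<omega>
    unfolding R_def
  proof (intro connected_continuous_image continuous_on_compose2[OF holomorphic_on_imp_continuous_on[OF \<psi>(1)]])
    show "(\<lambda>s. \<rho> * \<omega> * of_real s) ` {0<..<\<eta>} \<subseteq> \<phi> ` ball w r" using ray_N[OF that] N by blast
  qed (auto intro!: continuous_intros)
  have "\<exists>e \<in> edges P c1 c2. R \<omega> \<subseteq> e" if "\<omega> \<in> \<Omega>" for \<omega>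
  proof -
    have "R \<omega> \<noteq> {}" using \<eta>(1) by (simp add: R_def)
    then have "?F \<noteq> {}" using R_F[OF that] by blast
    then show ?thesis
      unfolding edges_def using exists_component_superset[OF R_F[OF that] _ R_conn[OF that]] by blast
  qed
  then obtain E where E: "\<And>\<omega>. \<omega> \<in> \<Omega> \<Longrightarrow> E \<omega> \<in> edges P c1 c2" "\<And>\<omega>. \<omega> \<in> \<Omega> \<Longrightarrow> R \<omega> \<subseteq> E \<omega>"
    by metis
  have \<phi>_ray: "\<phi> z \<in> (\<lambda>s. \<rho> * \<omega> * of_real s) ` {0<..<\<eta>}" if "z \<in> R \<omega>" "\<omega> \<in> \<Omega>" for z \<omega>
    using that \<psi>N(2) ray_N unfolding R_def by (auto simp: image_iff)
  \<comment> \<open>For a preimage point near \<open>w\<close>, the \<open>m\<close>-th power of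
    \<open>\<phi> z / \<rho>\<close> is a positive real, so its quotient by its norm is an
    \<open>m\<close>-th root of unity.\<close>
  have ray_cover: "\<exists>\<omega>\<in>\<Omega>. z \<in> R \<omega>" if z: "z \<in> B" "z \<in> ?F" for z
  proof -
    obtain \<tau> where \<tau>: "0 < \<tau>" "\<tau> < 1" "poly P z = (1 - \<tau>) *\<^sub>R c2 + \<tau> *\<^sub>R c1"
      using z(2) unfolding open_segment_commute[of c1] in_segment by auto
    define u where "u = \<phi> z / \<rho>"
    define s where "s = norm u"
    have "\<phi> z ^ m = of_real \<tau> * (c1 - c2)"
      using P\<phi>[of z] z(1) \<tau>(3) by (simp add: B_def scaleR_conv_of_real algebra_simps)
    then have um: "u ^ m = of_real \<tau>"
      using ends_distinct by (simp add: u_def power_divide \<rho>(1))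
    then have sm: "s ^ m = \<tau>" using \<tau>(1) by (simp add: s_def flip: norm_power)
    then have s0: "s > 0" using \<tau>(1) m
      by (metis norm_ge_zero s_def less_le power_0_left gr_implies_not0 less_irrefl)
    have "s < \<eta>" using z(1) \<rho>(2) by (simp add: s_def u_def B_def norm_divide field_simps)
    define \<omega> where "\<omega> = u / of_real s"
    have "\<omega> \<in> \<Omega>" using um sm \<tau>(1) by (simp add: \<Omega>_def \<omega>_def power_divide flip: of_real_power)
    moreover have "\<phi> z = \<rho> * \<omega> * of_real s" using s0 \<rho>(2) by (simp add: \<omega>_def u_def)
    then have "z = \<psi> (\<rho> * \<omega> * of_real s)" using \<psi>(2)[of z] z(1) by (simp add: B_def)
    then have "z \<in> R \<omega>" using s0 \<open>s < \<eta>\<close> by (auto simp: R_def)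
    ultimately show ?thesis by blast
  qed
  \<comment> \<open>Two rays in one edge would give two points of the edge, at the same parameter
    \<open>\<eta> / 2\<close>, with equal value under \<open>poly P\<close>.\<close>
  have E_inj: "\<omega> = \<omega>'" if "E \<omega> = E \<omega>'" and \<omega>: "\<omega> \<in> \<Omega>" "\<omega>' \<in> \<Omega>" for \<omega> \<omega>'
  proof -
    let ?s = "\<eta> / 2"
    have s: "?s \<in> {0<..<\<eta>}" using \<eta>(1) by simp
    have "\<psi> (\<rho> * \<omega> * of_real ?s) = \<psi> (\<rho> * \<omega>' * of_real ?s)"
    proof (rule inj_onD[OF edge_inj[OF E(1)[OF \<omega>(1)]]])
      show "poly P (\<psi> (\<rho> * \<omega> * of_real ?s)) = poly P (\<psi> (\<rho> * \<omega>' * of_real ?s))"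
        by (simp only: P_ray[OF \<omega>(1) s] P_ray[OF \<omega>(2) s])
      show "\<psi> (\<rho> * \<omega> * of_real ?s) \<in> E \<omega>"
        using E(2)[OF \<omega>(1)] s unfolding R_def by blast
      show "\<psi> (\<rho> * \<omega>' * of_real ?s) \<in> E \<omega>"
        using E(2)[OF \<omega>(2)] s \<open>E \<omega> = E \<omega>'\<close> unfolding R_def by blast
    qed
    then have "\<rho> * \<omega> * of_real ?s = \<rho> * \<omega>' * of_real ?s"
      using \<psi>N(2)[OF ray_N[OF \<omega>(1) s]] \<psi>N(2)[OF ray_N[OF \<omega>(2) s]] by metis
    then show ?thesis using \<rho>(2) \<eta>(1) by simp
  qed
  \<comment> \<open>Inside \<open>B\<close> an edge consists of its own ray only, so a limit at
    \<open>w\<close> within the whole edge can be computed along the ray.\<close>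
  have E_ray: "z \<in> R \<omega>" if z: "z \<in> B" "z \<in> E \<omega>" and \<omega>: "\<omega> \<in> \<Omega>" for z \<omega>
  proof -
    have "z \<in> ?F" using z(2) E(1)[OF \<omega>] in_components_subset unfolding edges_def by blast
    then obtain \<omega>' where \<omega>': "\<omega>' \<in> \<Omega>" "z \<in> R \<omega>'" using ray_cover z(1) by blast
    then have "E \<omega> = E \<omega>'" using edges_disjoint[OF E(1)[OF \<omega>] E(1)] z(2) E(2) by blast
    then show ?thesis using E_inj \<omega> \<omega>' by metis
  qed
  have w_closure: "w \<in> closure (E \<omega>)" if \<omega>: "\<omega> \<in> \<Omega>" for \<omega>
  proof -
    have "0 \<in> \<phi> ` ball w r" by fact
    then have "isCont \<psi> 0"
      using \<psi>(1) \<open>open (\<phi> ` ball w r)\<close> holomorphic_on_imp_continuous_on continuous_on_eq_continuous_at by metis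
    moreover have "((\<lambda>s::real. \<rho> * \<omega> * of_real s) \<longlongrightarrow> 0) (at_right 0)"
      by (auto intro!: tendsto_eq_intros)
    ultimately have "((\<lambda>s::real. \<psi> (\<rho> * \<omega> * of_real s)) \<longlongrightarrow> \<psi> 0) (at_right 0)"
      by (rule isCont_tendsto_compose)
    moreover have "\<psi> 0 = w" using \<psi>(2)[of w] r(1) by (simp add: \<phi>_def)
    ultimately have lim: "((\<lambda>s::real. \<psi> (\<rho> * \<omega> * of_real s)) \<longlongrightarrow> w) (at_right 0)" by simp
    show ?thesis
    proof (rule Lim_in_closed_set[OF closed_closure _ _ lim])
      show "\<forall>\<^sub>F s in at_right 0. \<psi> (\<rho> * \<omega> * of_real s) \<in> closure (E \<omega>)"
        unfolding eventually_at_right_field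
      proof (intro exI[of _ \<eta>] conjI allI impI)
        fix s assume "0 < s" "s < \<eta>"
        then have "\<psi> (\<rho> * \<omega> * of_real s) \<in> R \<omega>" by (auto simp: R_def)
        then show "\<psi> (\<rho> * \<omega> * of_real s) \<in> closure (E \<omega>)"
          using E(2)[OF \<omega>] closure_subset by blast
      qed (rule \<eta>(1))
    qed simp
  qed
  have bijE: "bij_betw E \<Omega> (edges_at P c1 c2 w)"
  proof (rule bij_betw_imageI)
    show "inj_on E \<Omega>" using E_inj by (auto intro: inj_onI)
    show "E ` \<Omega> = edges_at P c1 c2 w"
    proof
      show "E ` \<Omega> \<subseteq> edges_at P c1 c2 w"
        using E(1) w_closure by (auto simp: edges_at_def)
      show "edges_at P c1 c2 w \<subseteq> E ` \<Omega>"
      proof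
        fix e assume "e \<in> edges_at P c1 c2 w"
        then have e: "e \<in> edges P c1 c2" "w \<in> closure e" by (auto simp: edges_at_def)
        then obtain z where z: "z \<in> B" "z \<in> e"
          using openB wB by (metis disjoint_iff open_Int_closure_eq_empty)
        have "z \<in> ?F" using z(2) e(1) in_components_subset unfolding edges_def by blast
        then obtain \<omega> where \<omega>: "\<omega> \<in> \<Omega>" "z \<in> R \<omega>" using ray_cover z(1) by blast
        then have "e = E \<omega>" using edges_disjoint[OF e(1) E(1)] z(2) E(2) by blast
        then show "e \<in> E ` \<Omega>" using \<omega> by blast
      qed
    qed
  qed
  \<comment> \<open>On a ray \<open>(z - w) * g z\<close> equals
    \<open>\<rho> * \<omega> * of_real s\<close> with \<open>s > 0\<close>. Taking signs and letting
    \<open>z\<close> tend to \<open>w\<close> gives the direction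
    \<open>\<kappa> * \<omega>\<close>.\<close>
  define \<kappa> where "\<kappa> = sgn \<rho> / sgn (g w)"
  have norm\<kappa>: "norm \<kappa> = 1" using \<rho>(2) gnz by (simp add: \<kappa>_def norm_divide norm_sgn)
  have lim: "((\<lambda>z. sgn (z - w)) \<longlongrightarrow> \<kappa> * \<omega>) (at w within E \<omega>)" if \<omega>: "\<omega> \<in> \<Omega>" for \<omega>
  proof (rule Lim_transform_eventually[of "\<lambda>z. sgn \<rho> / sgn (g z) * \<omega>"])
    have "isCont g w"
      using holg r0(1) holomorphic_on_imp_continuous_on continuous_on_eq_continuous_at
      by (metis centre_in_ball open_ball)
    then have "(g \<longlongrightarrow> g w) (at w within E \<omega>)"
      by (meson continuous_within continuous_at_imp_continuous_at_within)
    then show "((\<lambda>z. sgn \<rho> / sgn (g z) * \<omega>) \<longlongrightarrow> \<kappa> * \<omega>) (at w within E \<omega>)"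
      unfolding \<kappa>_def using gnz by (intro tendsto_intros) (auto simp: sgn_zero_iff)
    have "\<forall>\<^sub>F z in at w within E \<omega>. z \<in> B \<inter> E \<omega>"
      unfolding eventually_at_topological using openB wB by blast
    then show "\<forall>\<^sub>F z in at w within E \<omega>. sgn \<rho> / sgn (g z) * \<omega> = sgn (z - w)"
    proof eventually_elim
      case (elim z)
      then obtain s where s: "s > 0" "(z - w) * g z = \<rho> * \<omega> * of_real s"
        using \<phi>_ray[OF E_ray[OF _ _ \<omega>] \<omega>, of z] by (auto simp: \<phi>_def)
      have "sgn (z - w) * sgn (g z) = sgn \<rho> * \<omega>"
        using arg_cong[OF s(2), of sgn] s(1) norm\<Omega>[OF \<omega>]
        by (simp add: sgn_mult sgn_of_real) (simp add: sgn_div_norm)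
      then show ?case using gnz[of z] by (simp add: field_simps sgn_zero_iff)
    qed
  qed
  \<comment> \<open>The inverse of \<open>E\<close> recovers the root of unity of an edge. The
    directions are then the solutions of \<open>d ^ m = \<kappa> ^ m\<close>, so
    \<open>\<kappa> ^ m\<close> serves as \<open>\<zeta>\<close>.\<close>
  define D where "D = (\<lambda>\<omega>. \<kappa> * \<omega>) \<circ> the_inv_into \<Omega> E"
  have D_E: "D (E \<omega>) = \<kappa> * \<omega>" if "\<omega> \<in> \<Omega>" for \<omega>
    unfolding D_def using that bijE by (simp add: bij_betw_def the_inv_into_f_f)
  have "bij_betw (\<lambda>\<omega>. \<kappa> * \<omega>) \<Omega> {d. d ^ m = \<kappa> ^ m}"
    by (rule bij_betw_byWitness[where f' = "\<lambda>d. d / \<kappa>"])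
      (use norm\<kappa> in \<open>auto simp: \<Omega>_def power_mult_distrib power_divide\<close>)
  then have "bij_betw D (edges_at P c1 c2 w) {d. d ^ vertex_degree P w = \<kappa> ^ m}"
    unfolding D_def m_def[symmetric]
    by (rule bij_betw_trans[OF bij_betw_the_inv_into[OF bijE]])
  moreover have "((\<lambda>z. sgn (z - w)) \<longlongrightarrow> D e) (at w within e)" if "e \<in> edges_at P c1 c2 w" for e
    using that lim D_E bijE by (metis bij_betw_imp_surj_on imageE)
  moreover have "norm (\<kappa> ^ m) = 1" by (simp add: norm_power norm\<kappa>)
  ultimately show ?thesis using that by blast
qed

text \<open>Reduces the cyclic order to naming \<open>m\<close> edges with equally spaced
  directions. Distinct directions make the edges distinct, and a nonzero number has exactly
  \<open>m\<close> roots of order \<open>m\<close>, so no edge at \<open>w\<close> is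
  missed.\<close>

lemma black_degrees_aroundI:
  assumes D: "bij_betw D (edges_at P c1 c2 w) {d. d ^ m = \<zeta>}"
    and tangent: "\<And>e. e \<in> edges_at P c1 c2 w \<Longrightarrow> ((\<lambda>z. sgn (z - w)) \<longlongrightarrow> D e) (at w within e)"
    and m: "0 < m" and \<zeta>: "\<zeta> \<noteq> 0" and len: "length bs = m"
    and e: "\<And>k. k < m \<Longrightarrow> e k \<in> edges_at P c1 c2 w"
    and De: "\<And>k. k < m \<Longrightarrow> D (e k) = cis (\<alpha> + 2 * pi * real k / real m)"
    and b: "\<And>k. k < m \<Longrightarrow> poly P (bs ! k) = c1" "\<And>k. k < m \<Longrightarrow> bs ! k \<in> closure (e k)"
  shows "black_degrees_around P c1 c2 w (map (vertex_degree P) bs)"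
proof -
  have inj: "inj_on e {..<m}"
  proof (rule inj_onI)
    fix j k assume jk: "j \<in> {..<m}" "k \<in> {..<m}" "e j = e k"
    then have "cis (\<alpha> + 2 * pi * real j / real m) = cis (\<alpha> + 2 * pi * real k / real m)"
      using De by (metis lessThan_iff)
    then have "cis (2 * pi * real j / real m) = cis (2 * pi * real k / real m)"
      by (simp flip: cis_mult)
    then show "j = k"
      using Complex.bij_betw_roots_unity[OF m] jk by (auto simp: bij_betw_def inj_on_def)
  qed
  have fin: "finite (edges_at P c1 c2 w)"
    using bij_betw_finite[OF D] finite_nth_roots[OF m] by blast
  have "card (edges_at P c1 c2 w) = m"
    using bij_betw_same_card[OF D] card_nth_roots[OF \<zeta> m] by simp
  then have range: "e ` {..<m} = edges_at P c1 c2 w"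
    using e inj by (intro card_subset_eq fin) (auto simp: card_image)
  have "ccw_edges_at P c1 c2 w (map e [0..<m])"
    unfolding ccw_edges_at_def
  proof (intro conjI exI[of _ "\<lambda>k. \<alpha> + 2 * pi * real k / real m"] allI impI)
    show "distinct (map e [0..<m])" using inj by (simp add: distinct_map atLeast0LessThan)
    show "set (map e [0..<m]) = edges_at P c1 c2 w" using range by (simp add: atLeast0LessThan)
    show "strict_mono_on {..<length (map e [0..<m])} (\<lambda>k. \<alpha> + 2 * pi * real k / real m)"
      using m by (auto simp: strict_mono_on_def divide_strict_right_mono)
    fix k assume "k < length (map e [0..<m])"
    then have k: "k < m" by simp
    then show "\<alpha> + 2 * pi * real k / real m < \<alpha> + 2 * pi * real 0 / real m + 2 * pi"
      using m by (simp add: divide_less_eq)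
    show "((\<lambda>z. sgn (z - w)) \<longlongrightarrow> cis (\<alpha> + 2 * pi * real k / real m)) (at w within map e [0..<m] ! k)"
      using tangent[OF e[OF k]] De[OF k] k by simp
  qed
  moreover have "list_all2 (\<lambda>e v. v \<in> vertices P c1 \<and> v \<in> closure e) (map e [0..<m]) bs"
    using b len by (auto simp: list_all2_conv_all_nth vertices_def)
  ultimately show ?thesis unfolding black_degrees_around_def by blast
qed

text \<open>The open segment from \<open>w\<close> to \<open>b\<close> is connected, hence inside
  one edge, and its ends lie in the closure. The tangent of that edge can be computed along the
  segment, where the direction is constant.\<close>

lemma straight_edge:
  assumes D: "\<And>e. e \<in> edges_at P c1 c2 w \<Longrightarrow> ((\<lambda>z. sgn (z - w)) \<longlongrightarrow> D e) (at w within e)"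
    and "b \<noteq> w"
    and seg: "\<And>t. 0 < t \<Longrightarrow> t < 1 \<Longrightarrow> poly P (w + of_real t * (b - w)) \<in> open_segment c1 c2"
  shows "\<exists>e \<in> edges_at P c1 c2 w. D e = sgn (b - w) \<and> b \<in> closure e"
proof -
  let ?I = "open_segment w b"
  have par: "\<exists>t. 0 < t \<and> t < 1 \<and> z = w + of_real t * (b - w)" if "z \<in> ?I" for z
    using that by (auto simp: in_segment scaleR_conv_of_real algebra_simps)
  then have "?I \<subseteq> {z. poly P z \<in> open_segment c1 c2}" using seg by fastforce
  moreover have "?I \<noteq> {}" using \<open>b \<noteq> w\<close> by simp
  ultimately obtain e where e: "e \<in> edges P c1 c2" "?I \<subseteq> e"
    using exists_component_superset[of ?I "{z. poly P z \<in> open_segment c1 c2}"]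
      convex_connected[OF convex_open_segment[of w b]]
    unfolding edges_def by blast
  have cl: "closed_segment w b \<subseteq> closure e"
    using closure_mono[OF e(2)] \<open>b \<noteq> w\<close> by (simp add: closure_open_segment)
  then have e_at: "e \<in> edges_at P c1 c2 w" using e(1) by (auto simp: edges_at_def)
  have "((\<lambda>z. sgn (z - w)) \<longlongrightarrow> D e) (at w within ?I)"
    by (rule tendsto_within_subset[OF D[OF e_at] e(2)])
  moreover have "((\<lambda>z. sgn (z - w)) \<longlongrightarrow> sgn (b - w)) (at w within ?I)"
  proof (rule Lim_transform_eventually[OF tendsto_const])
    have "sgn (b - w) = sgn (z - w)" if "z \<in> ?I" for z
      using par[OF that] by (auto simp: sgn_mult sgn_of_real)
    then show "\<forall>\<^sub>F z in at w within ?I. sgn (b - w) = sgn (z - w)"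
      by (simp add: eventually_at_filter)
  qed
  \<comment> \<open>The point \<open>w\<close> is a limit point of the segment, so the two limits
    must agree.\<close>
  moreover have "?I - {w} = ?I" by (auto simp: open_segment_def)
  then have "at w within ?I \<noteq> bot"
    using \<open>b \<noteq> w\<close> by (auto simp: trivial_limit_within islimpt_in_closure closure_open_segment)
  ultimately have "D e = sgn (b - w)" using tendsto_unique by blast
  then show ?thesis using e_at cl by blast
qed

end

subsection \<open>Two pairs of roots and one white vertex of degree four\<close>

text \<open>With \<open>A\<close> and \<open>B\<close> the two monic quadratics,
  \<open>log_deriv\<close> reads \<open>r A' B + s B' A = k (x - w)^3\<close>; its left side is the
  numerator of \<open>P'/P\<close> over the denominator \<open>A B\<close>.\<close>

locale two_root_pairs =
  fixes r s :: nat and v1 v2 u1 u2 w k :: complex and P :: "complex poly"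
  assumes P_def: "P = ([:- v1, 1:] * [:- v2, 1:]) ^ r * ([:- u1, 1:] * [:- u2, 1:]) ^ s"
    and pos: "0 < r" "0 < s"
    and distinct: "distinct [v1, v2, u1, u2]" and w_root: "w \<notin> {v1, v2, u1, u2}" and k: "k \<noteq> 0"
    and log_deriv: "smult (of_nat r) ([:- v1 - v2, 2:] * ([:- u1, 1:] * [:- u2, 1:])) +
      smult (of_nat s) ([:- u1 - u2, 2:] * ([:- v1, 1:] * [:- v2, 1:])) = smult k ([:- w, 1:] ^ 3)"
begin

text \<open>The monic gcd of \<open>P\<close> and \<open>pderiv P\<close>: every root of
  \<open>P\<close> with multiplicity lowered by one.\<close>

definition Q :: "complex poly" where
  "Q = ([:- v1, 1:] * [:- v2, 1:]) ^ (r - 1) * ([:- u1, 1:] * [:- u2, 1:]) ^ (s - 1)"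

lemma pderiv_P: "pderiv P = smult k (Q * [:- w, 1:] ^ 3)"
proof -
  define A B where "A = [:- v1, 1:] * [:- v2, 1:]" and "B = [:- u1, 1:] * [:- u2, 1:]"
  have dA: "pderiv A = [:- v1 - v2, 2:]" and dB: "pderiv B = [:- u1 - u2, 2:]"
    by (simp_all add: A_def B_def pderiv_pCons pderiv_mult)
  obtain r' s' where rs: "r = Suc r'" "s = Suc s'" using pos by (metis gr0_conv_Suc)
  have Q: "Q = A ^ r' * B ^ s'" unfolding Q_def A_def B_def by (simp only: rs diff_Suc_1)
  have "pderiv P = A ^ r' * B ^ s' *
      (smult (of_nat r) (pderiv A * B) + smult (of_nat s) (pderiv B * A))"
    unfolding P_def A_def[symmetric] B_def[symmetric] rs pderiv_mult pderiv_power_Suc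
    by (simp add: algebra_simps del: of_nat_Suc)
  also have "\<dots> = Q * smult k ([:- w, 1:] ^ 3)"
    by (simp only: Q dA dB log_deriv[folded A_def B_def])
  finally show ?thesis by simp
qed

lemma Q_w: "poly Q w \<noteq> 0"
  using w_root by (auto simp: Q_def simp del: mult_pCons_left mult_pCons_right)

lemma P_nz: "P \<noteq> 0"
  by (auto simp: P_def)

lemma proots_P: "proots P = repeat_mset r {#v1, v2#} + repeat_mset s {#u1, u2#}"
  unfolding P_def by (subst proots_mult) (auto simp: proots_power proots_mult simp del: mult_pCons_left mult_pCons_right)

lemma degree_P: "degree P = 2 * r + 2 * s"
  by (simp add: proots_P flip: size_proots_complex)

lemma P_roots: "poly P z = 0 \<longleftrightarrow> z \<in> {v1, v2, u1, u2}"
  using pos by (auto simp: P_def simp del: mult_pCons_left mult_pCons_right)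

lemma vertex_degree_root:
  assumes "poly P z = 0"
  shows "vertex_degree P z = (if z \<in> {v1, v2} then r else s)"
proof -
  have "vertex_degree P z = count (proots P) z"
    using P_nz assms by (simp add: vertex_degree_def)
  then show ?thesis using assms distinct by (auto simp: proots_P P_roots)
qed

sublocale shabat_polynomial P 0 "poly P w"
proof
  have "poly P z = 0 \<or> z = w" if "poly (pderiv P) z = 0" for z
    using that k pos by (auto simp: pderiv_P Q_def P_roots simp del: mult_pCons_left mult_pCons_right)
  then show "shabat P 0 (poly P w)"
    using degree_P pos w_root P_roots[of w] by (auto simp: shabat_def critical_values_def)
qed

lemma black_partition: "degree_partition P 0 = replicate_mset 2 r + replicate_mset 2 s"
proof -
  have "vertices P 0 = {v1, v2, u1, u2}" using P_roots by (auto simp: vertices_def)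
  moreover have "u1 \<noteq> v1" "u2 \<noteq> v1" "u1 \<noteq> v2" "u2 \<noteq> v2" using distinct by auto
  ultimately show ?thesis
    using distinct vertex_degree_root
    by (simp add: degree_partition_def P_roots numeral_2_eq_2)
qed

text \<open>The derivative vanishes at \<open>w\<close> to order exactly three, because
  \<open>Q\<close> does not vanish there.\<close>

lemma vertex_degree_w: "vertex_degree P w = 4"
proof -
  have nz: "P - [:poly P w:] \<noteq> 0"
    using deg by (metis degree_pCons_0 eq_iff_diff_eq_0 less_irrefl)
  have "Q * [:- w, 1:] ^ 3 \<noteq> 0" using Q_w by auto
  then have "order w (pderiv P) = 3"
    using k Q_w by (simp add: pderiv_P order_smult order_mult order_power_n_n order_0I)
  then show ?thesis
    unfolding vertex_degree_def using order_pderiv[OF nz, of w] by (simp add: pderiv_diff pderiv_pCons)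
qed

text \<open>All white vertices other than \<open>w\<close> are noncritical, hence of degree one; the
  total multiplicity \<open>2 * r + 2 * s\<close> then gives their number.\<close>

lemma white_partition:
  "degree_partition P (poly P w) = {#4#} + replicate_mset (2 * r + 2 * s - 4) 1"
proof -
  define V where "V = vertices P (poly P w) - {w}"
  have fin: "finite V" unfolding V_def vertices_def using fibre_finite[OF deg] by auto
  have V: "vertices P (poly P w) = insert w V" "w \<notin> V" by (auto simp: V_def vertices_def)
  have "vertex_degree P z = 1" if "z \<in> V" for z
  proof -
    have "poly P z = poly P w" "z \<noteq> w" using that by (auto simp: V_def vertices_def)
    moreover have "poly Q z \<noteq> 0"
    proof
      assume "poly Q z = 0"
      then have "poly P z = 0" by (auto simp: Q_def P_roots simp del: mult_pCons_left mult_pCons_right)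
      then show False using \<open>poly P z = poly P w\<close> ends_distinct by simp
    qed
    ultimately have "poly (pderiv P) z \<noteq> 0" using k by (simp add: pderiv_P)
    then show ?thesis
      unfolding vertex_degree_def by (rule order_noncritical[OF deg])
  qed
  then have "image_mset (vertex_degree P) (mset_set V) = image_mset (\<lambda>_. 1) (mset_set V)"
    using fin by (intro image_mset_cong) auto
  then have part: "degree_partition P (poly P w) = {#4#} + replicate_mset (card V) 1"
    using fin V(2) by (simp add: degree_partition_def V(1) vertex_degree_w image_mset_const_eq)
  have "4 + card V = 2 * r + 2 * s"
    using sum_mset_degree_partition[OF deg, of "poly P w"] degree_P by (simp add: part)
  then show ?thesis unfolding part by (metis add_diff_cancel_left')
qed

lemma shabat_tree_with_orderI:
  assumes "black_degrees_around P 0 (poly P w) w ds"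
  shows "shabat_tree_with_order r s ds P"
  unfolding shabat_tree_with_order_def Let_def passport_def
  using shabat black_partition white_partition card_edges degree_P vertex_degree_w assms
  by (intro exI[of _ "poly P w"] conjI bexI[of _ w]) (simp_all add: vertices_def)

end

subsection \<open>The tree with cyclic order \<open>r, s, r, s\<close>\<close>

lemma in_open_segment_0:
  fixes z c :: complex
  shows "z \<in> open_segment 0 c \<longleftrightarrow> 0 \<noteq> c \<and> (\<exists>t. 0 < t \<and> t < 1 \<and> z = of_real t * c)"
  by (auto simp: in_segment scaleR_conv_of_real)

lemma cis_add_quarter: "cis (\<alpha> + 2 * pi * real k / 4) = cis \<alpha> * \<i> ^ k"
proof -
  have "\<i> ^ k = cis (real k * (pi / 2))" using Complex.DeMoivre[of "pi / 2" k] by simp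
  then show ?thesis by (simp add: cis_mult field_simps)
qed

text \<open>Compare \<open>1 - y\<close> with \<open>exp (- y)\<close> and \<open>1 + x\<close> with
  \<open>exp x\<close> for \<open>x = y * (r/s)\<close>: the weighted exponents \<open>- r y\<close>
  and \<open>s x\<close> cancel.\<close>

lemma weighted_product_less_1:
  fixes y :: real
  assumes "0 < y" "y < 1" "0 < r" "0 < s"
  shows "(1 - y) ^ r * (1 + y * (real r / real s)) ^ s < 1"
proof -
  define x where "x = y * (real r / real s)"
  have x: "x > 0" using assms by (simp add: x_def)
  have "1 + x < exp x"
    using exp_lower_Taylor_quadratic[of x] x by (smt (verit) zero_less_power divide_pos_pos)
  then have "(1 + x) ^ s < exp x ^ s" using x assms(4) by (intro power_strict_mono) auto
  moreover have "(1 - y) ^ r \<le> exp (- y) ^ r"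
    using exp_ge_add_one_self[of "- y"] assms by (intro power_mono) auto
  ultimately have "(1 - y) ^ r * (1 + x) ^ s < exp (- y) ^ r * exp x ^ s"
    using assms x by (intro mult_le_less_imp_less) auto
  also have "\<dots> = exp (real r * (- y) + real s * x)"
    by (simp only: exp_of_nat_mult exp_add)
  also have "real r * (- y) + real s * x = 0" using assms(4) by (simp add: x_def)
  finally show ?thesis by (simp add: x_def)
qed

text \<open>With \<open>c = 0\<close> the numerator of \<open>P'/P\<close> is
  \<open>2 (r + s) x^3 + 2 (r b + s a) x\<close>. The choice of \<open>a\<close> removes the linear
  term, so the white vertex of degree four is \<open>0\<close>.\<close>

lemma shabat_of_T21_P_family:
  assumes pos: "0 < r" "0 < s" and "b \<noteq> 0"
  shows "shabat_of_T21 r s (P_family r s (- (b * of_nat r / of_nat s)) b 0)"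
proof -
  define F where "F = P_family r s (- (b * of_nat r / of_nat s)) b 0"
  \<comment> \<open>The edges at \<open>0\<close> are the straight segments to the roots \<open>\<plusminus>\<kappa>\<close> and \<open>\<plusminus>U\<close>, on two perpendicular lines.\<close>
  define \<kappa> where "\<kappa> = csqrt (b * of_nat r / of_nat s)"
  define \<mu> where "\<mu> = sqrt (real s / real r)"
  define U where "U = \<i> * of_real \<mu> * \<kappa>"
  have \<kappa>2: "\<kappa>\<^sup>2 = b * of_nat r / of_nat s" by (simp add: \<kappa>_def)
  have \<kappa>0: "\<kappa> \<noteq> 0" using assms by (auto simp: \<kappa>_def)
  have \<mu>: "\<mu> > 0" "\<mu>\<^sup>2 = real s / real r" using pos by (auto simp: \<mu>_def)
  have \<mu>2: "(of_real \<mu> :: complex)\<^sup>2 = of_nat s / of_nat r"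
    using \<mu>(2) by (metis of_real_divide of_real_of_nat_eq of_real_power)
  have U2: "U\<^sup>2 = - b"
    using pos by (simp add: U_def power_mult_distrib \<kappa>2 \<mu>2)
  have "\<i> * complex_of_real \<mu> \<noteq> 1" "\<i> * complex_of_real \<mu> \<noteq> -1"
    by (auto simp: complex_eq_iff)
  then have U: "U \<noteq> 0" "U \<noteq> \<kappa>" "U \<noteq> - \<kappa>"
    using \<kappa>0 \<mu>(1) mult_cancel_right[of "\<i> * of_real \<mu>" \<kappa> 1] mult_cancel_right[of "\<i> * of_real \<mu>" \<kappa> "-1"]
    by (auto simp: U_def)
  have Q1: "[:- \<kappa>, 1:] * [:- (- \<kappa>), 1:] = [:- (b * of_nat r / of_nat s), 0, 1:]"
    and Q2: "[:- U, 1:] * [:- (- U), 1:] = [:b, 0, 1:]"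
    using \<kappa>2 U2 by (simp_all add: power2_eq_square)
  interpret two_root_pairs r s \<kappa> "- \<kappa>" U "- U" 0 "2 * (of_nat r + of_nat s)" F
  proof
    show "F = ([:- \<kappa>, 1:] * [:- (- \<kappa>), 1:]) ^ r * ([:- U, 1:] * [:- (- U), 1:]) ^ s"
      unfolding Q1 Q2 by (simp add: F_def P_family_def)
    show "distinct [\<kappa>, - \<kappa>, U, - U]" using U \<kappa>0 by auto
    show "2 * (of_nat r + of_nat s) \<noteq> (0::complex)" using pos by (simp flip: of_nat_add)
    show "smult (of_nat r) ([:- \<kappa> - - \<kappa>, 2:] * ([:- U, 1:] * [:- (- U), 1:])) +
      smult (of_nat s) ([:- U - - U, 2:] * ([:- \<kappa>, 1:] * [:- (- \<kappa>), 1:])) =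
      smult (2 * (of_nat r + of_nat s)) ([:- 0, 1:] ^ 3)"
      unfolding Q1 Q2 using pos by (simp add: power3_eq_cube)
  qed (use pos \<kappa>0 U in auto)
  have Pz: "poly F z = (z\<^sup>2 - \<kappa>\<^sup>2) ^ r * (z\<^sup>2 - U\<^sup>2) ^ s" for z
    unfolding \<kappa>2 U2 F_def P_family_def by (simp add: power2_eq_square add.commute)
  have P0: "poly F 0 = (- (\<kappa>\<^sup>2)) ^ r * (- (U\<^sup>2)) ^ s"
    using Pz[of 0] by simp
  have seg: "of_real x * poly F 0 \<in> open_segment 0 (poly F 0)" if "0 < x" "x < 1" for x :: real
    using that ends_distinct by (auto simp: in_open_segment_0)
  have \<kappa>U: "\<kappa>\<^sup>2 = - (U\<^sup>2 * (of_nat r / of_nat s))" by (simp add: \<kappa>2 U2)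
  have U\<kappa>: "U\<^sup>2 = - (\<kappa>\<^sup>2 * (of_nat s / of_nat r))" using pos by (simp add: \<kappa>2 U2)
  \<comment> \<open>On each of the two lines both quadratic factors are positive real multiples of
    their values at \<open>0\<close>, so \<open>poly F\<close> is a real multiple of
    \<open>poly F 0\<close>. The second line repeats the first with \<open>r\<close>,
    \<open>s\<close> and \<open>\<kappa>\<close>, \<open>U\<close> exchanged.\<close>
  have ray: "poly F (of_real t * z) \<in> open_segment 0 (poly F 0)"
    if t: "0 < t" "t < 1" and z: "z\<^sup>2 = \<kappa>\<^sup>2 \<or> z\<^sup>2 = U\<^sup>2" for t :: real and z
    using z
  proof
    assume z: "z\<^sup>2 = \<kappa>\<^sup>2"
    have "(of_real t * z)\<^sup>2 - \<kappa>\<^sup>2 = of_real (1 - t\<^sup>2) * (- (\<kappa>\<^sup>2))"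
      by (simp add: power_mult_distrib z algebra_simps)
    moreover have "(of_real t * z)\<^sup>2 - U\<^sup>2 = of_real (1 + t\<^sup>2 * (real r / real s)) * (- (U\<^sup>2))"
      by (simp add: power_mult_distrib z \<kappa>U algebra_simps)
    ultimately have "poly F (of_real t * z) =
        of_real ((1 - t\<^sup>2) ^ r * (1 + t\<^sup>2 * (real r / real s)) ^ s) * poly F 0"
      unfolding Pz[of "of_real t * z"] P0 by (simp only: power_mult_distrib of_real_mult of_real_power mult_ac)
    moreover have "(1 - t\<^sup>2) ^ r * (1 + t\<^sup>2 * (real r / real s)) ^ s < 1"
      using t pos by (intro weighted_product_less_1) (auto simp: power_less_one_iff)
    moreover have "0 < (1 - t\<^sup>2) ^ r * (1 + t\<^sup>2 * (real r / real s)) ^ s"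
      using t by (intro mult_pos_pos zero_less_power add_pos_nonneg) (auto simp: power_less_one_iff)
    ultimately show ?thesis by (simp only: seg)
  next
    assume z: "z\<^sup>2 = U\<^sup>2"
    have "(of_real t * z)\<^sup>2 - U\<^sup>2 = of_real (1 - t\<^sup>2) * (- (U\<^sup>2))"
      by (simp add: power_mult_distrib z algebra_simps)
    moreover have "(of_real t * z)\<^sup>2 - \<kappa>\<^sup>2 = of_real (1 + t\<^sup>2 * (real s / real r)) * (- (\<kappa>\<^sup>2))"
      by (simp add: power_mult_distrib z U\<kappa> algebra_simps)
    ultimately have "poly F (of_real t * z) =
        of_real ((1 - t\<^sup>2) ^ s * (1 + t\<^sup>2 * (real s / real r)) ^ r) * poly F 0"
      unfolding Pz[of "of_real t * z"] P0 by (simp only: power_mult_distrib of_real_mult of_real_power mult_ac)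
    moreover have "(1 - t\<^sup>2) ^ s * (1 + t\<^sup>2 * (real s / real r)) ^ r < 1"
      using t pos by (intro weighted_product_less_1) (auto simp: power_less_one_iff)
    moreover have "0 < (1 - t\<^sup>2) ^ s * (1 + t\<^sup>2 * (real s / real r)) ^ r"
      using t by (intro mult_pos_pos zero_less_power add_pos_nonneg) (auto simp: power_less_one_iff)
    ultimately show ?thesis by (simp only: seg)
  qed
  obtain D \<zeta> where \<zeta>: "norm \<zeta> = 1"
    and D: "bij_betw D (edges_at F 0 (poly F 0) 0) {d. d ^ 4 = \<zeta>}"
    and tangent: "\<And>e. e \<in> edges_at F 0 (poly F 0) 0 \<Longrightarrow> ((\<lambda>z. sgn (z - 0)) \<longlongrightarrow> D e) (at 0 within e)"
    using edge_tangents[of 0] vertex_degree_w by metis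
  \<comment> \<open>Listed counterclockwise: each direction is \<open>\<i>\<close> times the
    previous one.\<close>
  define bs where "bs = [\<kappa>, U, - \<kappa>, - U]"
  have less4: "k \<in> {0, 1, 2, 3}" if "k < 4" for k :: nat using that by auto
  have bs2: "(bs ! k)\<^sup>2 = \<kappa>\<^sup>2 \<or> (bs ! k)\<^sup>2 = U\<^sup>2" if "k < 4" for k
    using less4[OF that] by (auto simp: bs_def)
  have bs0: "bs ! k \<noteq> 0" if "k < 4" for k
    using less4[OF that] U \<kappa>0 by (auto simp: bs_def)
  have sgnU: "sgn U = \<i> * sgn \<kappa>"
    using \<mu>(1) by (simp add: U_def sgn_mult sgn_of_real) (simp add: sgn_div_norm)
  have dir: "sgn (bs ! k) = cis (Arg \<kappa> + 2 * pi * real k / real 4)" if "k < 4" for k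
    using less4[OF that] \<kappa>0 cis_add_quarter[of "Arg \<kappa>" k]
    by (auto simp: bs_def cis_Arg sgnU sgn_minus power3_eq_cube)
  have "\<exists>e \<in> edges_at F 0 (poly F 0) 0. D e = sgn (bs ! k - 0) \<and> bs ! k \<in> closure e" if "k < 4" for k
    by (rule straight_edge[OF tangent]) (use ray bs2 bs0 that in auto)
  then obtain e where e: "\<And>k. k < 4 \<Longrightarrow> e k \<in> edges_at F 0 (poly F 0) 0"
      "\<And>k. k < 4 \<Longrightarrow> D (e k) = sgn (bs ! k)" "\<And>k. k < 4 \<Longrightarrow> bs ! k \<in> closure (e k)"
    by (metis diff_zero)
  have root: "poly F (bs ! k) = 0" if "k < 4" for k
    using less4[OF that] by (auto simp: bs_def P_roots)
  have "black_degrees_around F 0 (poly F 0) 0 (map (vertex_degree F) bs)"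
    by (rule black_degrees_aroundI[OF D tangent, where e = e and \<alpha> = "Arg \<kappa>"])
      (use \<zeta> e dir root in \<open>auto simp: bs_def\<close>)
  moreover have "map (vertex_degree F) bs = [r, s, r, s]"
    using U \<kappa>0 by (auto simp: bs_def vertex_degree_root P_roots)
  ultimately have "shabat_tree_with_order r s [r, s, r, s] F"
    using shabat_tree_with_orderI by simp
  then show ?thesis by (simp add: shabat_of_T21_def F_def)
qed

subsection \<open>The tree with cyclic order \<open>r, r, s, s\<close>\<close>

text \<open>Both quadratics are real without real roots, so \<open>P\<close> is positive on the real
  axis and its tree is symmetric under conjugation.\<close>

locale conjugate_root_pairs =
  two_root_pairs r s v "cnj v" u "cnj u" "of_real w" "of_real k" P
  for r s and v u :: complex and w k :: real and P +
  assumes Im_v: "0 < Im v" and Im_u: "0 < Im u" and k_pos: "0 < k"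
begin

lemma pair_real: "poly ([:- a, 1:] * [:- cnj a, 1:]) (of_real x) = of_real ((norm (of_real x - a))\<^sup>2)"
  by (simp only: complex_norm_square poly_mult) (simp add: algebra_simps)

lemma P_real: "poly P (of_real x) =
    of_real (((norm (of_real x - v))\<^sup>2) ^ r * ((norm (of_real x - u))\<^sup>2) ^ s)"
  by (simp only: P_def poly_mult[of "_ ^ _"] poly_power pair_real of_real_mult of_real_power)

lemma Q_real: "poly Q (of_real x) =
    of_real (((norm (of_real x - v))\<^sup>2) ^ (r - 1) * ((norm (of_real x - u))\<^sup>2) ^ (s - 1))"
  by (simp only: Q_def poly_mult[of "_ ^ _"] poly_power pair_real of_real_mult of_real_power)

lemma P_cnj: "poly P (cnj z) = cnj (poly P z)"
  by (simp add: P_def mult.commute del: mult_pCons_left mult_pCons_right)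

lemma P_w_pos: "0 < Re (poly P (of_real w))" "of_real (Re (poly P (of_real w))) = poly P (of_real w)"
proof -
  define X where "X = ((norm (of_real w - v))\<^sup>2) ^ r * ((norm (of_real w - u))\<^sup>2) ^ s"
  have PX: "poly P (of_real w) = of_real X" unfolding X_def by (rule P_real)
  have "0 \<le> X" by (simp add: X_def)
  moreover have "X \<noteq> 0" using ends_distinct PX by auto
  ultimately show "0 < Re (poly P (of_real w))" by (simp add: PX)
  show "of_real (Re (poly P (of_real w))) = poly P (of_real w)" by (simp add: PX)
qed

text \<open>No edge crosses the real axis, as \<open>P\<close> attains its minimum over it at the white vertex \<open>w\<close>.\<close>

lemma P_real_ge: "Re (poly P (of_real w)) \<le> Re (poly P (of_real x))"
proof -
  \<comment> \<open>On the real axis this is \<open>k\<close> times \<open>Q\<close>, hence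
    nonnegative, so the sign of the derivative is governed by \<open>(x - w) ^ 3\<close>.\<close>
  let ?q = "\<lambda>x. k * (((norm (of_real x - v))\<^sup>2) ^ (r - 1) * ((norm (of_real x - u))\<^sup>2) ^ (s - 1))"
  have "((\<lambda>x. Re (poly P (of_real x))) has_field_derivative Re (poly (pderiv P) (of_real x))) (at x)" for x
    by (intro has_field_derivative_Re has_vector_derivative_real_field poly_DERIV)
  moreover have "Re (poly (pderiv P) (of_real x)) = ?q x * (x - w) ^ 3" for x
  proof -
    have "poly (pderiv P) (of_real x) = of_real (?q x * (x - w) ^ 3)"
      by (simp add: pderiv_P Q_real)
    then show ?thesis by (metis Re_complex_of_real)
  qed
  ultimately have deriv: "((\<lambda>x. Re (poly P (of_real x))) has_field_derivative ?q x * (x - w) ^ 3) (at x)" for x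
    by metis
  have q: "?q x \<ge> 0" for x using k_pos by simp
  show ?thesis
  proof (cases "w \<le> x")
    case True
    then show ?thesis
    proof (rule DERIV_nonneg_imp_nondecreasing)
      fix y assume "w \<le> y"
      then have "0 \<le> ?q y * (y - w) ^ 3" by (intro mult_nonneg_nonneg[OF q]) simp
      then show "\<exists>d. ((\<lambda>x. Re (poly P (of_real x))) has_field_derivative d) (at y) \<and> 0 \<le> d"
        using deriv[of y] by blast
    qed
  next
    case False
    then have "x \<le> w" by simp
    then show ?thesis
    proof (rule DERIV_nonpos_imp_nonincreasing)
      fix y assume "y \<le> w"
      then have "(y - w) ^ 3 \<le> 0" by (simp add: power_le_zero_eq)
      then have "?q y * (y - w) ^ 3 \<le> 0" by (intro mult_nonneg_nonpos[OF q])
      then show "\<exists>d. ((\<lambda>x. Re (poly P (of_real x))) has_field_derivative d) (at y) \<and> d \<le> 0"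
        using deriv[of y] by blast
    qed
  qed
qed

abbreviation "c2 \<equiv> poly P (of_real w)"

lemma edge_not_real:
  assumes "e \<in> edges P 0 c2" "z \<in> e"
  shows "Im z \<noteq> 0"
proof
  assume "Im z = 0"
  then have z: "z = of_real (Re z)" by (simp add: complex_eq_iff)
  have "poly P z \<in> open_segment 0 c2"
    using assms in_components_subset unfolding edges_def by blast
  then obtain t where t: "t < 1" "poly P z = of_real t * c2"
    unfolding in_open_segment_0 by blast
  have "Re (poly P z) = t * Re c2" using t(2) by simp
  moreover have "t * Re c2 < Re c2" using t(1) P_w_pos(1) by simp
  ultimately show False using P_real_ge[of "Re z"] z by simp
qed

lemma edge_half_plane:
  assumes e: "e \<in> edges P 0 c2"
  shows "(\<forall>z\<in>e. 0 < Im z) \<or> (\<forall>z\<in>e. Im z < 0)"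
proof (rule ccontr)
  assume "\<not> ?thesis"
  then obtain x y where xy: "x \<in> e" "y \<in> e" "\<not> 0 < Im x" "\<not> Im y < 0" by blast
  have "connected (Im ` e)"
    using in_components_connected e unfolding edges_def
    by (intro connected_continuous_image continuous_intros) blast
  then have "{Im x..Im y} \<subseteq> Im ` e" by (rule connected_contains_Icc) (use xy in auto)
  moreover have "0 \<in> {Im x..Im y}" using xy by simp
  ultimately have "0 \<in> Im ` e" by blast
  then show False using edge_not_real[OF e] by auto
qed

text \<open>As \<open>c2\<close> is real, conjugation preserves the preimage and maps each edge into
  some edge. Doing it twice returns to the original edge, so the inclusions are equalities.\<close>

lemma cnj_edge:
  assumes e: "e \<in> edges P 0 c2"
  shows "cnj ` e \<in> edges P 0 c2"
proof -
  let ?F = "{z. poly P z \<in> open_segment 0 c2}"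
  have cnj_F: "cnj z \<in> ?F" if z: "z \<in> ?F" for z
  proof -
    obtain t where t: "0 < t" "t < 1" "poly P z = of_real t * c2"
      using z unfolding mem_Collect_eq in_open_segment_0 by blast
    have "cnj c2 = c2" using P_w_pos(2) by (metis complex_cnj_complex_of_real)
    then have "poly P (cnj z) = of_real t * c2" using t(3) by (simp add: P_cnj)
    then show ?thesis using t ends_distinct unfolding mem_Collect_eq in_open_segment_0 by blast
  qed
  have step: "\<exists>e'\<in>edges P 0 c2. cnj ` e \<subseteq> e'" if e: "e \<in> edges P 0 c2" for e
  proof -
    have "connected (cnj ` e)" 
      using in_components_connected e unfolding edges_def
      by (intro connected_continuous_image continuous_intros) blast
    moreover have sub: "e \<subseteq> ?F" using e in_components_subset unfolding edges_def by blast
    then have "cnj ` e \<subseteq> ?F" using cnj_F by blast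
    moreover have "e \<noteq> {}" using e in_components_nonempty unfolding edges_def by blast
    then have "?F \<noteq> {}" using sub by blast
    ultimately show ?thesis using exists_component_superset[of "cnj ` e" ?F] unfolding edges_def by blast
  qed
  obtain e' where e': "e' \<in> edges P 0 c2" "cnj ` e \<subseteq> e'" using step[OF e] by blast
  obtain e'' where e'': "e'' \<in> edges P 0 c2" "cnj ` e' \<subseteq> e''" using step[OF e'(1)] by blast
  have cc: "cnj ` cnj ` A = A" for A by (force simp: image_iff)
  have "e \<noteq> {}" using e in_components_nonempty unfolding edges_def by blast
  moreover have "e \<subseteq> e''" using image_mono[OF e'(2), of cnj] e''(2) cc by blast
  ultimately have "e'' = e" using edges_disjoint[OF e''(1) e] by blast
  then have "e' \<subseteq> cnj ` e" using image_mono[OF e''(2), of cnj] cc by blast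
  then show ?thesis using e' by (metis subset_antisym)
qed

lemma cnj_closure: "z \<in> closure e \<Longrightarrow> cnj z \<in> closure (cnj ` e)"
proof -
  assume "z \<in> closure e"
  have "cnj ` closure e \<subseteq> closure (cnj ` e)"
  proof (rule image_closure_subset)
    show "continuous_on (closure e) cnj" by (intro continuous_intros)
  qed (simp_all add: closure_subset)
  then show ?thesis using \<open>z \<in> closure e\<close> by blast
qed

lemma cnj_edge_at:
  assumes "e \<in> edges_at P 0 c2 (of_real w)"
  shows "cnj ` e \<in> edges_at P 0 c2 (of_real w)"
  using assms cnj_edge cnj_closure[of "of_real w" e] by (simp add: edges_at_def)

text \<open>Guarantees that the tangent direction of an edge at \<open>w\<close> is unique.\<close>

lemma edge_at_not_bot:
  assumes "e \<in> edges_at P 0 c2 (of_real w)"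
  shows "at (of_real w) within e \<noteq> bot"
proof -
  have "complex_of_real w \<notin> e" using edge_not_real[of e "of_real w"] assms by (auto simp: edges_at_def)
  then show ?thesis
    using assms by (auto simp: edges_at_def trivial_limit_within islimpt_in_closure)
qed

lemma tangent_cnj:
  assumes lim: "((\<lambda>z. sgn (z - of_real w)) \<longlongrightarrow> d) (at (of_real w) within e)"
  shows "((\<lambda>z. sgn (z - of_real w)) \<longlongrightarrow> cnj d) (at (of_real w) within cnj ` e)"
proof -
  have "((\<lambda>z. cnj z) \<longlongrightarrow> of_real w) (at (of_real w) within cnj ` e)"
    by (auto intro!: tendsto_eq_intros)
  moreover have "\<forall>\<^sub>F z in at (of_real w) within cnj ` e. cnj z \<in> e \<and> cnj z \<noteq> of_real w"
    unfolding eventually_at_filter by (auto simp: complex_eq_iff intro!: always_eventually)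
  ultimately have "filterlim cnj (at (of_real w) within e) (at (of_real w) within cnj ` e)"
    by (simp add: filterlim_at)
  note this = tendsto_cnj[OF filterlim_compose[OF lim this]]
  moreover have "cnj (sgn (cnj z - of_real w)) = sgn (z - of_real w)" for z
  proof -
    have "cnj z - of_real w = cnj (z - of_real w)" by simp
    then show ?thesis
      by (simp only: Complex.sgn_eq complex_cnj_divide complex_mod_cnj complex_cnj_cnj complex_cnj_complex_of_real)
  qed
  ultimately show ?thesis by simp
qed

text \<open>The closure of an upper edge stays in the closed upper half plane, where the only roots
  are \<open>v\<close> and \<open>u\<close>.\<close>

lemma black_end:
  assumes e: "e \<in> edges P 0 c2" and up: "\<forall>z\<in>e. 0 < Im z"
  obtains b where "b \<in> closure e" "poly P b = 0" "b \<in> {v, u}"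
proof -
  obtain \<gamma> where \<gamma>: "\<And>t. t \<in> {0..1} \<Longrightarrow> poly P (\<gamma> t) = linepath 0 c2 t" "closure e = path_image \<gamma>"
    using edge_arc[OF e] by metis
  have P0: "poly P (\<gamma> 0) = 0" using \<gamma>(1)[of 0] by (simp add: linepath_0')
  have cl: "\<gamma> 0 \<in> closure e" using \<gamma>(2) by (simp add: path_image_def)
  have "closure e \<subseteq> {z. 0 \<le> Im z}"
    using up by (intro closure_minimal closed_halfspace_Im_ge) (auto intro: less_imp_le)
  then have "0 \<le> Im (\<gamma> 0)" using cl by blast
  then have "\<gamma> 0 \<in> {v, u}" using P0 Im_v Im_u unfolding P_roots by auto
  then show ?thesis using that cl P0 by blast
qed

lemma black_degrees: "black_degrees_around P 0 c2 (of_real w) [r, r, s, s]"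
proof -
  let ?E = "edges_at P 0 c2 (of_real w)"
  obtain D \<zeta> where \<zeta>: "norm \<zeta> = 1"
    and D: "bij_betw D ?E {d. d ^ 4 = \<zeta>}"
    and tangent: "\<And>e. e \<in> ?E \<Longrightarrow> ((\<lambda>z. sgn (z - of_real w)) \<longlongrightarrow> D e) (at (of_real w) within e)"
    using edge_tangents[of "of_real w"] vertex_degree_w by metis
  have edge: "e \<in> edges P 0 c2" if "e \<in> ?E" for e using that by (simp add: edges_at_def)
  have D_inj: "e = e'" if "e \<in> ?E" "e' \<in> ?E" "D e = D e'" for e e'
    using D that by (auto simp: bij_betw_def dest: inj_onD)
  have D4: "D e ^ 4 = \<zeta>" if "e \<in> ?E" for e using D that by (auto simp: bij_betw_def)
  have D_surj: "\<exists>e\<in>?E. D e = d" if "d ^ 4 = \<zeta>" for d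
  proof -
    have "d \<in> D ` ?E" using D that by (simp add: bij_betw_def)
    then show ?thesis by blast
  qed
  have D_cnj: "D (cnj ` e) = cnj (D e)" if e: "e \<in> ?E" for e
    using tendsto_unique[OF edge_at_not_bot[OF cnj_edge_at[OF e]] tangent[OF cnj_edge_at[OF e]]
        tangent_cnj[OF tangent[OF e]]] .
  \<comment> \<open>A real direction would make the edge its own conjugate, although it lies in an
    open half plane.\<close>
  have not_real: "cnj (D e) \<noteq> D e" if e: "e \<in> ?E" for e
  proof
    assume "cnj (D e) = D e"
    then have "cnj ` e = e" using D_inj[OF cnj_edge_at[OF e] e] D_cnj[OF e] by simp
    moreover have "e \<noteq> {}" using edge[OF e] in_components_nonempty unfolding edges_def by blast
    then obtain z where "z \<in> e" by blast
    ultimately have "cnj z \<in> e" by blast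
    with \<open>z \<in> e\<close> have "0 < Im z \<and> 0 < Im (cnj z) \<or> Im z < 0 \<and> Im (cnj z) < 0"
      using edge_half_plane[OF edge[OF e]] by blast
    then show False by auto
  qed
  \<comment> \<open>An edge below the real axis would approach \<open>w\<close> with sines that are
    not positive, so the limit direction could not point upwards.\<close>
  have up: "\<forall>z\<in>e. 0 < Im z" if e: "e \<in> ?E" and "0 < Im (D e)" for e
  proof (rule ccontr)
    assume "\<not> ?thesis"
    then have down: "\<forall>z\<in>e. Im z < 0" using edge_half_plane[OF edge[OF e]] by blast
    have "((\<lambda>z. Im (sgn (z - of_real w))) \<longlongrightarrow> Im (D e)) (at (of_real w) within e)"
      by (intro tendsto_Im tangent e)
    moreover have "\<forall>\<^sub>F z in at (of_real w) within e. Im (sgn (z - of_real w)) \<le> 0"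
      unfolding eventually_at_filter
      using down by (intro always_eventually) (auto simp: sgn_div_norm mult_le_0_iff divide_nonpos_nonneg)
    ultimately have "Im (D e) \<le> 0"
      using edge_at_not_bot[OF e] by (intro tendsto_upperbound)
    then show False using \<open>0 < Im (D e)\<close> by simp
  qed
  \<comment> \<open>The four directions are permuted by conjugation and none is real, so \<open>\<zeta>\<close> is real but not \<open>1\<close>.\<close>
  have \<zeta>1: "\<zeta> = -1"
  proof -
    have "card {d. d ^ 4 = \<zeta>} = 4" using \<zeta> by (intro card_nth_roots) auto
    then obtain d where d: "d ^ 4 = \<zeta>"
      by (metis (mono_tags, lifting) card.empty empty_Collect_eq zero_neq_numeral)
    then obtain e where e: "e \<in> ?E" "D e = d" using D_surj by blast
    have "cnj \<zeta> = \<zeta>" using D4[OF cnj_edge_at[OF e(1)]] D_cnj[OF e(1)] d e(2) by (metis complex_cnj_power)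
    then have "\<zeta> = of_real (Re \<zeta>)" by (simp add: complex_eq_iff)
    then have "\<zeta> = 1 \<or> \<zeta> = -1" using \<zeta> by (metis abs_eq_iff' norm_of_real of_real_1 of_real_minus abs_1)
    moreover have "\<zeta> \<noteq> 1"
    proof
      assume "\<zeta> = 1"
      then obtain e where "e \<in> ?E" "D e = 1" using D_surj[of 1] by auto
      then show False using not_real[of e] by simp
    qed
    ultimately show ?thesis by blast
  qed
  \<comment> \<open>The directions are now \<open>\<omega>\<close>, \<open>\<i> * \<omega>\<close>,
    \<open>- \<omega>\<close> and \<open>- \<i> * \<omega>\<close>; the first two point upwards and
    the other two are their conjugates in reverse order.\<close>
  define \<omega> where "\<omega> = cis (pi / 4)"
  have \<omega>2: "\<omega> * \<omega> = \<i>" unfolding \<omega>_def cis_mult by simp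
  have \<omega>4: "\<omega> ^ 4 = -1" using \<omega>2 by (simp add: power4_eq_xxxx mult.assoc[symmetric]) (simp add: mult.assoc)
  have Im\<omega>: "0 < Im \<omega>" "0 < Re \<omega>" by (simp_all add: \<omega>_def sin_45 cos_45)
  have cnj\<omega>: "cnj \<omega> = - \<i> * \<omega>"
    by (simp add: \<omega>_def complex_eq_iff sin_45 cos_45)
  have i\<omega>i: "\<i> * \<omega> * \<i> = - \<omega>" by (simp add: complex_eq_iff)
  obtain e0 where e0: "e0 \<in> ?E" "D e0 = \<omega>" using D_surj[of \<omega>] \<omega>4 \<zeta>1 by auto
  obtain e1 where e1: "e1 \<in> ?E" "D e1 = \<i> * \<omega>"
    using D_surj[of "\<i> * \<omega>"] \<omega>4 \<zeta>1 by (auto simp: power_mult_distrib)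
  note e0' = cnj_edge_at[OF e0(1)] and e1' = cnj_edge_at[OF e1(1)]
  have De0': "D (cnj ` e0) = - \<i> * \<omega>" and De1': "D (cnj ` e1) = - \<omega>"
    using D_cnj[OF e0(1)] D_cnj[OF e1(1)] by (simp_all add: e0(2) e1(2) cnj\<omega>)
  have up0: "\<forall>z\<in>e0. 0 < Im z" and up1: "\<forall>z\<in>e1. 0 < Im z"
    using up[OF e0(1)] up[OF e1(1)] Im\<omega> by (auto simp: e0(2) e1(2))
  obtain b0 where b0: "b0 \<in> closure e0" "poly P b0 = 0" "b0 \<in> {v, u}"
    using black_end[OF edge[OF e0(1)] up0] .
  obtain b1 where b1: "b1 \<in> closure e1" "poly P b1 = 0" "b1 \<in> {v, u}"
    using black_end[OF edge[OF e1(1)] up1] .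
  have "e0 \<noteq> e1" using e0 e1 Im\<omega> by (auto simp: complex_eq_iff)
  \<comment> \<open>Otherwise the two upper edges would share both the white end \<open>w\<close>
    and the black end.\<close>
  then have "b0 \<noteq> b1"
    using edges_common_ends[OF edge[OF e0(1)] edge[OF e1(1)], of b0 "of_real w"] b0 b1 e0(1) e1(1)
    by (auto simp: edges_at_def)
  have cnj_root: "poly P (cnj z) = 0" if "poly P z = 0" for z using that by (simp add: P_cnj)
  have deg: "map (vertex_degree P) [v, cnj v, cnj u, u] = [r, r, s, s]"
    "map (vertex_degree P) [cnj v, v, u, cnj u] = [r, r, s, s]"
    using distinct by (auto simp: vertex_degree_root P_roots)
  have less4: "k \<in> {0, 1, 2, 3}" if "k < 4" for k :: nat using that by auto
  have around: "black_degrees_around P 0 c2 (of_real w) (map (vertex_degree P) bs)"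
    if len: "length es = 4" "length bs = 4" and es: "set es \<subseteq> ?E" and d: "D (es ! 0) = cis \<alpha>"
      "D (es ! 1) = cis \<alpha> * \<i>" "D (es ! 2) = - cis \<alpha>" "D (es ! 3) = - (cis \<alpha> * \<i>)"
      and bs: "list_all2 (\<lambda>e b. b \<in> closure e \<and> poly P b = 0) es bs" for es bs \<alpha>
  proof (rule black_degrees_aroundI[OF D tangent, where e = "\<lambda>k. es ! k" and \<alpha> = \<alpha>])
    fix k :: nat assume k: "k < 4"
    show "es ! k \<in> ?E" using k es len(1) by (metis nth_mem subsetD)
    show "D (es ! k) = cis (\<alpha> + 2 * pi * real k / real 4)"
      using less4[OF k] d cis_add_quarter[of \<alpha> k] by (auto simp: power3_eq_cube)
    show "poly P (bs ! k) = 0" "bs ! k \<in> closure (es ! k)"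
      using bs k len by (auto simp: list_all2_conv_all_nth)
  qed (use len \<zeta>1 in auto)
  \<comment> \<open>Which upper edge ends in \<open>v\<close> is left open: both cases give the same cyclic order.\<close>
  show ?thesis
  proof (cases "b0 = v")
    case True
    then have b1u: "b1 = u" using b1(3) \<open>b0 \<noteq> b1\<close> by auto
    \<comment> \<open>The list starts at the lower right edge, so that the two ends
      \<open>cnj v\<close> and \<open>v\<close> of degree \<open>r\<close> come first.\<close>
    have "cis (- (pi / 4)) = cnj \<omega>" by (simp add: \<omega>_def cis_cnj)
    then have "cis (- (pi / 4)) = - \<i> * \<omega>" by (simp only: cnj\<omega>)
    then have "black_degrees_around P 0 c2 (of_real w) (map (vertex_degree P) [cnj v, v, u, cnj u])"
      using e0 e1 e0' e1' De0' De1' b0 b1 cnj_closure[OF b0(1)] cnj_closure[OF b1(1)] cnj_root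
      by (intro around[where es = "[cnj ` e0, e0, e1, cnj ` e1]" and \<alpha> = "- (pi / 4)"])
        (simp_all add: True b1u i\<omega>i)
    then show ?thesis unfolding deg .
  next
    case False
    then have b0u: "b0 = u" using b0(3) by auto
    then have b1v: "b1 = v" using b1(3) \<open>b0 \<noteq> b1\<close> by auto
    \<comment> \<open>Here the vertices of degree \<open>r\<close> lie on the left, so the list
      starts at the upper left edge.\<close>
    have "cis (pi / 4 + pi / 2) = \<i> * \<omega>" unfolding cis_mult[symmetric] by (simp add: \<omega>_def)
    then have "black_degrees_around P 0 c2 (of_real w) (map (vertex_degree P) [v, cnj v, cnj u, u])"
      using e0 e1 e0' e1' De0' De1' b0 b1 cnj_closure[OF b0(1)] cnj_closure[OF b1(1)] cnj_root
      by (intro around[where es = "[e1, cnj ` e1, cnj ` e0, e0]" and \<alpha> = "pi / 4 + pi / 2"])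
        (simp_all add: b0u b1v i\<omega>i)
    then show ?thesis unfolding deg .
  qed
qed

end

section \<open>Verification of the parameters for the second tree\<close>

text \<open>Comparing coefficients shows that the numerator of \<open>P'/P\<close> is
  \<open>2 N (x - w)^3\<close>; negative discriminants make both root pairs nonreal.\<close>

lemma shabat_of_T22_P_family:
  fixes C :: real
  assumes pos: "0 < r" "0 < s" and "C \<noteq> 0"
  defines "pA \<equiv> 32 * real r ^ 3 + 75 * real r ^ 2 * real s + 78 * real r * real s ^ 2 + 31 * real s ^ 3"
    and "pB \<equiv> 31 * real r ^ 3 + 75 * real r * real s ^ 2 + 78 * real r ^ 2 * real s + 32 * real s ^ 3"
  defines "A \<equiv> 1 / 108 * (C\<^sup>2 * pA / ((real r + real s)\<^sup>2 * real s))"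
    and "B \<equiv> 1 / 108 * (C\<^sup>2 * pB / ((real r + real s)\<^sup>2 * real r))"
  shows "shabat_of_T22 r s (P_family r s (of_real A) (of_real B) (of_real C))"
proof -
  define R S where "R = real r" and "S = real s"
  define N d where "N = R + S" and "d = R - S"
  \<comment> \<open>The coefficient of \<open>x^2\<close> in the numerator is
    \<open>C * (S - R)\<close>, and it has to equal \<open>- 6 * N * w\<close>.\<close>
  define w where "w = C * d / (6 * N)"
  have RS: "R > 0" "S > 0" "N > 0" using pos by (auto simp: R_def S_def N_def)
  note p = pA_def[folded R_def S_def] pB_def[folded R_def S_def]
  have SA: "S * A = C\<^sup>2 * pA / (108 * N\<^sup>2)" and RB: "R * B = C\<^sup>2 * pB / (108 * N\<^sup>2)"
    using RS by (simp_all add: A_def B_def flip: R_def S_def N_def)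
  \<comment> \<open>The constant coefficient involves \<open>pA\<close> and \<open>pB\<close> only
    through their difference, the linear one only through their sum; both are short in terms of
    \<open>N\<close> and \<open>d\<close>.\<close>
  have diff: "pB = pA - d ^ 3"
    by (simp add: p d_def power2_eq_square power3_eq_cube algebra_simps)
  have sum: "pA + pB = 54 * N ^ 3 + 9 * N * d\<^sup>2"
    by (simp add: p N_def d_def power2_eq_square power3_eq_cube algebra_simps)
  have coeff0: "C * (R * B) - C * (S * A) = - 2 * N * w ^ 3"
    unfolding SA RB diff w_def using RS(3)
    by (simp add: field_simps power2_eq_square power3_eq_cube)
  have "2 * (S * A) + 2 * (R * B) = C\<^sup>2 * (pA + pB) / (54 * N\<^sup>2)"
    unfolding SA RB using RS(3) by (simp add: field_simps)
  also have "\<dots> = C\<^sup>2 * N + 6 * N * w\<^sup>2"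
    unfolding sum w_def using RS(3)
    by (simp add: field_simps power2_eq_square power3_eq_cube)
  finally have coeff1: "2 * (S * A) + 2 * (R * B) - C\<^sup>2 * N = 6 * N * w\<^sup>2" by simp
  have coeff2: "C * (S - R) = - 6 * N * w"
    unfolding w_def d_def using RS(3) by (simp add: field_simps)
  \<comment> \<open>This is minus a quarter of the discriminant of \<open>x^2 + C x + A\<close>.
    After clearing denominators all coefficients are positive.\<close>
  have "A - C\<^sup>2 / 4 = C\<^sup>2 * (32 * R ^ 3 + 48 * R\<^sup>2 * S + 24 * R * S\<^sup>2 + 4 * S ^ 3) / (108 * N\<^sup>2 * S)"
    unfolding A_def p R_def[symmetric] S_def[symmetric] N_def using RS
    by (simp add: divide_simps) (simp add: power2_eq_square power3_eq_cube algebra_simps)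
  also have "\<dots> > 0"
    using RS \<open>C \<noteq> 0\<close> by (intro divide_pos_pos mult_pos_pos add_pos_pos) auto
  finally have posA: "0 < A - C\<^sup>2 / 4" .
  have "B - C\<^sup>2 / 4 = C\<^sup>2 * (4 * R ^ 3 + 24 * R\<^sup>2 * S + 48 * R * S\<^sup>2 + 32 * S ^ 3) / (108 * N\<^sup>2 * R)"
    unfolding B_def p R_def[symmetric] S_def[symmetric] N_def using RS
    by (simp add: divide_simps) (simp add: power2_eq_square power3_eq_cube algebra_simps)
  also have "\<dots> > 0"
    using RS \<open>C \<noteq> 0\<close> by (intro divide_pos_pos mult_pos_pos add_pos_pos) auto
  finally have posB: "0 < B - C\<^sup>2 / 4" .
  \<comment> \<open>The upper roots of \<open>x^2 + C x + A\<close> and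
    \<open>x^2 - C x + B\<close>; their real parts \<open>- C / 2\<close> and \<open>C / 2\<close>
    differ because \<open>C\<close> is nonzero.\<close>
  define v where "v = Complex (- C / 2) (sqrt (A - C\<^sup>2 / 4))"
  define u where "u = Complex (C / 2) (sqrt (B - C\<^sup>2 / 4))"
  have v: "v * cnj v = of_real A" "- v - cnj v = of_real C"
    using posA by (simp_all add: v_def complex_eq_iff flip: power2_eq_square) (simp add: power2_eq_square)
  have u: "u * cnj u = of_real B" "- u - cnj u = - of_real C"
    using posB by (simp_all add: u_def complex_eq_iff flip: power2_eq_square) (simp add: power2_eq_square)
  have Qv: "[:- v, 1:] * [:- cnj v, 1:] = [:of_real A, of_real C, 1:]"
  proof -
    have "- cnj v - v = - v - cnj v" by simp
    with v show ?thesis by (simp only: mult_pCons_left mult_pCons_right) (simp add: mult.commute)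
  qed
  have Qu: "[:- u, 1:] * [:- cnj u, 1:] = [:of_real B, - of_real C, 1:]"
  proof -
    have "- cnj u - u = - u - cnj u" by simp
    with u show ?thesis by (simp only: mult_pCons_left mult_pCons_right) (simp add: mult.commute)
  qed
  define F where "F = P_family r s (of_real A) (of_real B) (of_real C)"
  interpret conjugate_root_pairs r s v u w "2 * N" F
  proof
    show "F = ([:- v, 1:] * [:- cnj v, 1:]) ^ r * ([:- u, 1:] * [:- cnj u, 1:]) ^ s"
      unfolding Qv Qu by (simp add: F_def P_family_def)
    have "smult (of_nat r) ([:- v - cnj v, 2:] * ([:- u, 1:] * [:- cnj u, 1:])) +
        smult (of_nat s) ([:- u - cnj u, 2:] * ([:- v, 1:] * [:- cnj v, 1:])) =
        [:of_real (C * (R * B) - C * (S * A)), of_real (2 * (S * A) + 2 * (R * B) - C\<^sup>2 * N),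
          of_real (C * (S - R)), of_real (2 * N):]"
      unfolding Qv Qu u(2) v(2)
      by (simp add: R_def S_def N_def power2_eq_square algebra_simps)
    also have "\<dots> = smult (of_real (2 * N)) ([:- of_real w, 1:] ^ 3)"
      unfolding coeff0 coeff1 coeff2
      by (simp add: power2_eq_square power3_eq_cube algebra_simps)
    finally show "smult (of_nat r) ([:- v - cnj v, 2:] * ([:- u, 1:] * [:- cnj u, 1:])) +
        smult (of_nat s) ([:- u - cnj u, 2:] * ([:- v, 1:] * [:- cnj v, 1:])) =
        smult (of_real (2 * N)) ([:- of_real w, 1:] ^ 3)" .
    show "distinct [v, cnj v, u, cnj u]" "of_real w \<notin> {v, cnj v, u, cnj u}"
      using posA posB \<open>C \<noteq> 0\<close> by (auto simp: v_def u_def complex_eq_iff)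
    show "0 < Im v" "0 < Im u" using posA posB by (simp_all add: v_def u_def)
  qed (use pos RS in auto)
  have "shabat_tree_with_order r s [r, r, s, s] F"
    by (rule shabat_tree_with_orderI[OF black_degrees])
  then show ?thesis by (simp add: shabat_of_T22_def F_def)
qed

theorem lemma4p1:
  fixes r s :: nat
  assumes "0 < r" and "0 < s" and "r \<noteq> s"
  shows "(\<forall>b :: complex. b \<in> \<rat> \<and> b \<noteq> 0 \<longrightarrow>
            shabat_of_T21 r s (P_family r s (- (b * of_nat r / of_nat s)) b 0)) \<and>
         (\<forall>a b c :: complex. c \<in> \<rat> \<and> c \<noteq> 0 \<and>
            a = 1 / 108 * (c^2 * (32 * of_nat r ^ 3 + 75 * of_nat r ^ 2 * of_nat s
                                  + 78 * of_nat r * of_nat s ^ 2 + 31 * of_nat s ^ 3)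
                           / ((of_nat r + of_nat s) ^ 2 * of_nat s)) \<and>
            b = 1 / 108 * (c^2 * (31 * of_nat r ^ 3 + 75 * of_nat r * of_nat s ^ 2
                                  + 78 * of_nat r ^ 2 * of_nat s + 32 * of_nat s ^ 3)
                           / ((of_nat r + of_nat s) ^ 2 * of_nat r)) \<longrightarrow>
            shabat_of_T22 r s (P_family r s a b c))"
proof (intro conjI allI impI)
  fix b :: complex assume "b \<in> \<rat> \<and> b \<noteq> 0"
  then show "shabat_of_T21 r s (P_family r s (- (b * of_nat r / of_nat s)) b 0)"
    using assms shabat_of_T21_P_family by blast
next
  fix a b c :: complex
  assume H: "c \<in> \<rat> \<and> c \<noteq> 0 \<and>
            a = 1 / 108 * (c^2 * (32 * of_nat r ^ 3 + 75 * of_nat r ^ 2 * of_nat s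
                                  + 78 * of_nat r * of_nat s ^ 2 + 31 * of_nat s ^ 3)
                           / ((of_nat r + of_nat s) ^ 2 * of_nat s)) \<and>
            b = 1 / 108 * (c^2 * (31 * of_nat r ^ 3 + 75 * of_nat r * of_nat s ^ 2
                                  + 78 * of_nat r ^ 2 * of_nat s + 32 * of_nat s ^ 3)
                           / ((of_nat r + of_nat s) ^ 2 * of_nat r))"
  then obtain q where q: "c = of_rat q" by (auto elim: Rats_cases)
  \<comment> \<open>A rational \<open>c\<close> is the image of a real number, and then
    \<open>a\<close> and \<open>b\<close> are real as well, so conjugation symmetry is
    available.\<close>
  define C :: real where "C = of_rat q"
  have c: "c = of_real C" unfolding q C_def by (cases q) (simp add: of_rat_rat)
  have "C \<noteq> 0" using H c by auto
  from shabat_of_T22_P_family[OF assms(1,2) this]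
  show "shabat_of_T22 r s (P_family r s a b c)"
    using H by (simp add: c)
qed

end
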